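(* Let $\mathbb{D}$ be the closed disc and let $\Delta=(\mathbb{D},|{*}-{*}|)$ be a closed disc equipped with a $\mathrm{CAT}(\kappa)$ metric such that any two points of $\Delta$ are joined by a unique geodesic, and the geodesic depends continuously on its endpoints. Assume $f\colon\mathbb{D}\to\Delta$ is a saddle map and the restriction of $f$ to the boundary $\partial\mathbb{D}$ is a monotone map $\partial\mathbb{D}\to\partial\Delta$. Then $f$ is monotone.
   Context: Maps are assumed to be continuous. Here $\kappa$ is some real number, the metric on $\Delta$ induces the usual topology of the closed disc, and $\partial\Delta$ is the boundary circle. A geodesic $[x,y]$ is a minimizing (length-realizing) geodesic from $x$ to $y$. A map $f$ from a closed disc $\mathbb{D}$ to a surface $\Delta$ with possibly nonempty boundary and geodesic metric is called saddle if for any geodesic $[x,y]$ in $\Delta$, each connected component of the complement $\mathbb{D}\setminus f^{-1}([x,y])$ meets the boundary $\partial\mathbb{D}$. A continuous map $f\colon X\to Y$ is called monotone if the inverse image $f^{-1}\{y\}$ of any point $y\in Y$ is connected. A connected space is nonempty by definition, so any monotone map is onto. *)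

theory Defs
  imports "HOL-Analysis.Analysis"
begin

text \<open>
  The model plane of constant curvature \<open>\<kappa>\<close>, realized in \<open>real ^ 3\<close>: the unit sphere, a flat plane,
  or the upper sheet of the unit hyperboloid.  For \<open>\<kappa> \<noteq> 0\<close> the curvature enters only through the
  factor by which the distance of curvature \<open>1\<close> or \<open>-1\<close> is rescaled.
\<close>

definition model_plane :: "real \<Rightarrow> (real ^ 3) set" where
  "model_plane \<kappa> =
    (if \<kappa> > 0 then sphere 0 1
     else if \<kappa> = 0 then {x. x $ 3 = 0}
     else {x. (x $ 1)\<^sup>2 + (x $ 2)\<^sup>2 - (x $ 3)\<^sup>2 = - 1 \<and> x $ 3 > 0})"

definition model_dist :: "real \<Rightarrow> real ^ 3 \<Rightarrow> real ^ 3 \<Rightarrow> real" where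
  "model_dist \<kappa> x y =
    (if \<kappa> > 0 then arccos (x \<bullet> y) / sqrt \<kappa>
     else if \<kappa> = 0 then dist x y
     else arcosh (x $ 3 * y $ 3 - x $ 1 * y $ 1 - x $ 2 * y $ 2) / sqrt (- \<kappa>))"

text \<open>Connected spaces are understood to be nonempty, so the fibres of a monotone map are nonempty
  and the map is onto; the library's \<^const>\<open>monotone_map\<close> allows empty fibres.\<close>

definition monotone_onto :: "'a topology \<Rightarrow> 'b topology \<Rightarrow> ('a \<Rightarrow> 'b) \<Rightarrow> bool" where
  "monotone_onto X Y f \<longleftrightarrow>
    continuous_map X Y f \<and> monotone_map X Y f \<and>
    (\<forall>y \<in> topspace Y. {x \<in> topspace X. f x = y} \<noteq> {})"

context Metric_space
begin

text \<open>Minimizing geodesics, parametrized proportionally to arc length on \<open>[0,1]\<close>.\<close>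

definition geodesic_path :: "(real \<Rightarrow> 'a) \<Rightarrow> 'a \<Rightarrow> 'a \<Rightarrow> bool" where
  "geodesic_path \<gamma> x y \<longleftrightarrow>
    \<gamma> ` {0..1} \<subseteq> M \<and> \<gamma> 0 = x \<and> \<gamma> 1 = y \<and>
    (\<forall>s \<in> {0..1}. \<forall>t \<in> {0..1}. d (\<gamma> s) (\<gamma> t) = \<bar>s - t\<bar> * d x y)"

definition geodesic_segment :: "'a set \<Rightarrow> 'a \<Rightarrow> 'a \<Rightarrow> bool" where
  "geodesic_segment S x y \<longleftrightarrow> (\<exists>\<gamma>. geodesic_path \<gamma> x y \<and> S = \<gamma> ` {0..1})"

definition uniquely_geodesic :: bool where
  "uniquely_geodesic \<longleftrightarrow> (\<forall>x \<in> M. \<forall>y \<in> M. \<exists>!S. geodesic_segment S x y)"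

text \<open>Meant for uniquely geodesic spaces, where the choice \<open>c\<close> of geodesics is forced.  For compact
  \<open>M\<close>, joint continuity is the same as uniform convergence of the geodesics when the endpoints
  converge.\<close>

definition geodesics_continuous :: bool where
  "geodesics_continuous \<longleftrightarrow>
    (\<exists>c. (\<forall>x \<in> M. \<forall>y \<in> M. geodesic_path (c x y) x y) \<and>
         continuous_map
           (prod_topology (prod_topology mtopology mtopology) (top_of_set {0..1})) mtopology
           (\<lambda>((x, y), t). c x y t))"

text \<open>\<open>x'\<close> is a comparison point in the model segment \<open>[a', b']\<close> for a point \<open>x\<close> of the
  segment \<open>S = [a, b]\<close>; the two distance equations say that \<open>x'\<close> lies on a geodesic from \<open>a'\<close> to
  \<open>b'\<close>, since \<open>a'\<close> and \<open>b'\<close> are as far apart as \<open>a\<close> and \<open>b\<close>.\<close>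

definition comparison_on_side ::
  "real \<Rightarrow> 'a set \<Rightarrow> 'a \<Rightarrow> 'a \<Rightarrow> real ^ 3 \<Rightarrow> real ^ 3 \<Rightarrow> 'a \<Rightarrow> real ^ 3 \<Rightarrow> bool" where
  "comparison_on_side \<kappa> S a b a' b' x x' \<longleftrightarrow>
    x \<in> S \<and> x' \<in> model_plane \<kappa> \<and>
    model_dist \<kappa> a' x' = d a x \<and> model_dist \<kappa> x' b' = d x b"

text \<open>The inequality for the geodesic triangle with vertices \<open>p, q, r\<close> and sides
  \<open>A = [p, q]\<close>, \<open>B = [q, r]\<close>, \<open>C = [r, p]\<close>.\<close>

definition CAT_triangle ::
  "real \<Rightarrow> 'a \<Rightarrow> 'a \<Rightarrow> 'a \<Rightarrow> 'a set \<Rightarrow> 'a set \<Rightarrow> 'a set \<Rightarrow> bool" where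
  "CAT_triangle \<kappa> p q r A B C \<longleftrightarrow>
    (\<forall>p' \<in> model_plane \<kappa>. \<forall>q' \<in> model_plane \<kappa>. \<forall>r' \<in> model_plane \<kappa>.
      model_dist \<kappa> p' q' = d p q \<and> model_dist \<kappa> q' r' = d q r \<and> model_dist \<kappa> r' p' = d r p \<longrightarrow>
      (let cmp = (\<lambda>x x'. comparison_on_side \<kappa> A p q p' q' x x' \<or>
                         comparison_on_side \<kappa> B q r q' r' x x' \<or>
                         comparison_on_side \<kappa> C r p r' p' x x')
       in \<forall>x y x' y'. cmp x x' \<and> cmp y y' \<longrightarrow> d x y \<le> model_dist \<kappa> x' y'))"

text \<open>For \<open>\<kappa> > 0\<close> only points at distance less than \<open>pi / sqrt \<kappa>\<close> (the diameter of the model plane)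
  and triangles of perimeter less than twice this diameter are constrained.\<close>

definition CAT :: "real \<Rightarrow> bool" where
  "CAT \<kappa> \<longleftrightarrow>
    (\<forall>x \<in> M. \<forall>y \<in> M. (\<kappa> > 0 \<longrightarrow> d x y < pi / sqrt \<kappa>) \<longrightarrow> (\<exists>S. geodesic_segment S x y)) \<and>
    (\<forall>p \<in> M. \<forall>q \<in> M. \<forall>r \<in> M. \<forall>A B C.
      geodesic_segment A p q \<and> geodesic_segment B q r \<and> geodesic_segment C r p \<and>
      (\<kappa> > 0 \<longrightarrow> d p q + d q r + d r p < 2 * (pi / sqrt \<kappa>)) \<longrightarrow>
      CAT_triangle \<kappa> p q r A B C)"

definition saddle :: "(complex \<Rightarrow> 'a) \<Rightarrow> bool" where
  "saddle f \<longleftrightarrow>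
    continuous_map (top_of_set (cball 0 1)) mtopology f \<and>
    (\<forall>x \<in> M. \<forall>y \<in> M. \<forall>S. geodesic_segment S x y \<longrightarrow>
      (\<forall>K \<in> components (cball 0 1 - f -` S). K \<inter> sphere 0 1 \<noteq> {}))"

end

end

(*
Extend f radially to a map F of the plane, and prolong geodesics ending on the boundary circle by
radial rays to infinity.  The saddle condition then says that preimages of prolonged geodesics have
only unbounded complementary components.

Fix a point v and let K be its fibre.  For a boundary point q call a relatively clopen part A of K
detached along q if it can be cut off from infinity inside the preimage of the prolonged geodesic
[v, q]; this is an open condition on q.  If v lies on [p, q], the preimage of [p, q] does not
separate the plane, and Mayer-Vietoris shows that every clopen A is, up to complement, a sum
(symmetric difference) of a part detached along p and a part detached along q.

Now let p be fixed and let q run monotonically through the points with v on [p, q].  If A is detached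
along p and along q, then near each point of A the map F stays on one side of [p, q].  If q is
extremal, that side is forced, since otherwise moving q a little further would cut off a bounded
region around the point; hence A is detached along all boundary points on the other side.  Combined
with the sum formula this makes detachedness along q also a closed condition.  So a nonempty detached
A is detached along every boundary point; but then the side of [p, q] on which F stays is locally
constant in q, and the two extremal positions of q force opposite sides.  Hence no nonempty part is
detached, and by the sum formula K is connected.
*)
theory Submission
  imports Defs "HOL-Complex_Analysis.Winding_Numbers"
begin


subsection \<open>Geodesics in the disc\<close>

text \<open>The obstacle is the lack of tameness: geodesics from \<open>p\<close> may share an
  initial piece and then part, or touch the boundary circle, and a fibre is a possibly wild compact
  set. Two things make up for it. Geodesics from \<open>p\<close> are ordered by their endpoints on
  the circle, by a winding number argument; so a prolonged geodesic cuts the plane into two closed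
  sides that meet only in it. And parts of a fibre are handled through unicoherence of the plane and
  through logarithms of circle-valued functions, reduced mod 2 so that parts add by symmetric
  difference.

  The complement in the sum formula is dealt with by one further fact: if \<open>v\<close> lies on
  \<open>[p, q]\<close>, a part of \<open>K\<close> and its complement in \<open>K\<close> cannot be
  detached along \<open>p\<close> and along \<open>q\<close> respectively, since this would yield a
  nowhere zero function on the plane that winds around the circle. For empty \<open>K\<close> the
  same fact shows that fibres are nonempty.

  In the closedness argument the extremal \<open>q\<close> has to come before the limit point in the
  sweep. This is arranged by sweeping in the direction in which only the shorter arc back to
  \<open>p\<close> is left after the limit point.\<close>

locale geodesic_disc = Metric_space "cball (0::complex) 1" d
  for d :: "complex \<Rightarrow> complex \<Rightarrow> real" +
  fixes c :: "complex \<Rightarrow> complex \<Rightarrow> real \<Rightarrow> complex"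
  assumes uniquely_geodesic: uniquely_geodesic
    and geodesic: "\<lbrakk>norm x \<le> 1; norm y \<le> 1\<rbrakk> \<Longrightarrow> geodesic_path (c x y) x y"
    and cont_geodesic:
      "continuous_on ((cball 0 1 \<times> cball 0 1) \<times> {0..1}) (\<lambda>((x, y), t). c x y t)"
begin

definition seg :: "complex \<Rightarrow> complex \<Rightarrow> complex set" where
  "seg x y = c x y ` {0..1}"

lemma geodesic_segment_seg: "\<lbrakk>norm x \<le> 1; norm y \<le> 1\<rbrakk> \<Longrightarrow> geodesic_segment (seg x y) x y"
  using geodesic unfolding geodesic_segment_def seg_def by blast

lemma geodesic_dist:
  assumes "norm x \<le> 1" "norm y \<le> 1" "s \<in> {0..1}" "t \<in> {0..1}"
  shows "d (c x y s) (c x y t) = \<bar>s - t\<bar> * d x y"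
  using geodesic[OF assms(1,2)] assms(3,4) by (simp add: geodesic_path_def)

lemma geodesic_ends:
  assumes "norm x \<le> 1" "norm y \<le> 1"
  shows "c x y 0 = x" "c x y 1 = y"
  using geodesic[OF assms] by (simp_all add: geodesic_path_def)

lemma geodesic_in_disc:
  assumes "norm x \<le> 1" "norm y \<le> 1" "t \<in> {0..1}"
  shows "norm (c x y t) \<le> 1"
  using geodesic[OF assms(1,2)] assms(3) unfolding geodesic_path_def by (meson image_subset_iff mem_cball_0)

lemma seg_in_disc: "\<lbrakk>norm x \<le> 1; norm y \<le> 1; z \<in> seg x y\<rbrakk> \<Longrightarrow> norm z \<le> 1"
  by (auto simp: seg_def geodesic_in_disc)

lemma seg_ends: "\<lbrakk>norm x \<le> 1; norm y \<le> 1\<rbrakk> \<Longrightarrow> x \<in> seg x y \<and> y \<in> seg x y"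
  unfolding seg_def by (auto simp: image_iff geodesic_ends intro: bexI[of _ 0] bexI[of _ 1])

lemma tri: "\<lbrakk>norm x \<le> 1; norm y \<le> 1; norm z \<le> 1\<rbrakk> \<Longrightarrow> d x z \<le> d x y + d y z"
  by (rule triangle) simp_all

lemma dist_zero: "\<lbrakk>norm x \<le> 1; norm y \<le> 1; d x y \<le> 0\<rbrakk> \<Longrightarrow> x = y"
  using zero[of x y] nonneg[of x y] by simp

text \<open>This is the concatenation of \<open>[x, z]\<close> and \<open>[z, y]\<close>,
  parametrized proportionally to arc length. Strict positivity makes both divisions
  meaningful.\<close>

lemma geodesic_path_split:
  assumes xy: "norm x \<le> 1" "norm y \<le> 1" "norm z \<le> 1" and z: "d x z + d z y = d x y"
    and pos: "0 < d x z" "0 < d z y"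
  shows "geodesic_path (\<lambda>t. if t * d x y \<le> d x z then c x z (t * d x y / d x z)
                           else c z y ((t * d x y - d x z) / d z y)) x y"
proof -
  define D where "D = d x y"
  define g where "g = (\<lambda>t. if t * D \<le> d x z then c x z (t * D / d x z)
                           else c z y ((t * D - d x z) / d z y))"
  have D: "D = d x z + d z y" "D > 0" using z pos by (auto simp: D_def)
  have p1: "t * D / d x z \<in> {0..1}" if "t \<in> {0..1}" "t * D \<le> d x z" for t
    using that pos D by (auto simp: field_simps)
  have p2: "(t * D - d x z) / d z y \<in> {0..1}" if "t \<in> {0..1}" "\<not> t * D \<le> d x z" for t
  proof -
    have "t * D \<le> D" using that D by (simp add: mult_left_le_one_le)
    then show ?thesis using that pos D by (auto simp: field_simps)
  qed
  have in_disc: "norm (g t) \<le> 1" if "t \<in> {0..1}" for t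
    using p1 p2 that xy geodesic_in_disc by (auto simp: g_def simp del: atLeastAtMost_iff)
  have g0: "g 0 = x" using pos xy by (simp add: g_def geodesic_ends)
  have "\<not> D \<le> d x z" "(D - d x z) / d z y = 1" using pos D(1) by simp_all
  then have g1: "g 1 = y" using xy by (simp add: g_def geodesic_ends)
  have same: "d (g s) (g t) = (t - s) * D" if st: "s \<in> {0..1}" "t \<in> {0..1}" "s \<le> t" for s t
  proof -
    have sD: "s * D \<le> t * D" using st D by (simp add: mult_right_mono)
    have scale: "\<bar>u / a - w / a\<bar> * a = \<bar>u - w\<bar>" if "0 < a" for a u w :: real
      using that by (simp add: diff_divide_distrib[symmetric] abs_divide)
    have tsD: "\<bar>s * D - t * D\<bar> = (t - s) * D" using sD by (simp add: abs_if left_diff_distrib)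
    have left: "d (c x z (u / d x z)) (c x z (w / d x z)) = \<bar>u - w\<bar>"
      if "u / d x z \<in> {0..1}" "w / d x z \<in> {0..1}" for u w
      unfolding geodesic_dist[OF xy(1,3) that] using pos(1) by (rule scale)
    have right: "d (c z y (u / d z y)) (c z y (w / d z y)) = \<bar>u - w\<bar>"
      if "u / d z y \<in> {0..1}" "w / d z y \<in> {0..1}" for u w
      unfolding geodesic_dist[OF xy(3,2) that] using pos(2) by (rule scale)
    consider "t * D \<le> d x z" "s * D \<le> d x z" | "\<not> s * D \<le> d x z" "\<not> t * D \<le> d x z"
      | "s * D \<le> d x z" "\<not> t * D \<le> d x z" using sD by linarith
    then show ?thesis
    proof cases
      case 1
      then have "g s = c x z (s * D / d x z)" "g t = c x z (t * D / d x z)" by (simp_all add: g_def)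
      then show ?thesis
        using left[OF p1[OF st(1) 1(2)] p1[OF st(2) 1(1)]] tsD by metis
    next
      case 2
      then have "g s = c z y ((s * D - d x z) / d z y)" "g t = c z y ((t * D - d x z) / d z y)" by (simp_all add: g_def)
      then have "d (g s) (g t) = \<bar>(s * D - d x z) - (t * D - d x z)\<bar>"
        using right[OF p2[OF st(1) 2(1)] p2[OF st(2) 2(2)]] by metis
      then show ?thesis using tsD by simp
    next
      case 3
      have gs: "g s = c x z (s * D / d x z)" using 3 by (simp add: g_def)
      have gt: "g t = c z y ((t * D - d x z) / d z y)" using 3 by (simp add: g_def)
      have e1: "c x z (0 / d x z) = x" "c x z (d x z / d x z) = z" "c z y (0 / d z y) = z" "c z y (d z y / d z y) = y"
        using pos geodesic_ends[OF xy(1,3)] geodesic_ends[OF xy(3,2)] by simp_all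
      have i1: "0 / d x z \<in> {0..1}" "d x z / d x z \<in> {0..1}" "0 / d z y \<in> {0..1}" "d z y / d z y \<in> {0..1}"
        using pos by simp_all
      have "0 \<le> s * D" using st D by simp
      then have a: "d (g s) z = d x z - s * D" "d x (g s) = s * D"
        using left[OF p1[OF st(1) 3(1)] i1(2)] left[OF i1(1) p1[OF st(1) 3(1)]] 3 unfolding e1 gs by linarith+
      have "t * D \<le> D" using st D by (simp add: mult_left_le_one_le)
      then have b: "d z (g t) = t * D - d x z" "d (g t) y = D - t * D"
        using right[OF i1(3) p2[OF st(2) 3(2)]] right[OF p2[OF st(2) 3(2)] i1(4)] 3 D(1) unfolding e1 gt by linarith+
      have n: "norm (g s) \<le> 1" "norm (g t) \<le> 1" using in_disc st by blast+
      \<comment> \<open>For points on different sides of \<open>z\<close>, the triangle inequality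
        through \<open>z\<close> bounds the distance from above, and the total length
        \<open>d x y\<close> bounds it from below.\<close>
      have "d (g s) (g t) \<le> d (g s) z + d z (g t)" "d x y \<le> d x (g s) + d (g s) y" "d (g s) y \<le> d (g s) (g t) + d (g t) y"
        using tri[OF n(1) xy(3) n(2)] tri[OF xy(1) n(1) xy(2)] tri[OF n xy(2)] by simp_all
      then have "d (g s) (g t) = t * D - s * D" using a b D_def by linarith
      then show ?thesis by (simp add: left_diff_distrib)
    qed
  qed
  have "d (g s) (g t) = \<bar>s - t\<bar> * D" if "s \<in> {0..1}" "t \<in> {0..1}" for s t
    using same[OF that] same[OF that(2,1)] commute[of "g s" "g t"] by (cases "s \<le> t") (auto simp: abs_if)
  then have "geodesic_path g x y"
    using in_disc g0 g1 by (auto simp: geodesic_path_def D_def)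
  then show ?thesis unfolding g_def D_def .
qed

text \<open>By uniqueness, the concatenated geodesic through a point with equality in the triangle
  inequality is the segment itself. Order relations on segments thereby reduce to linear arithmetic
  with distances.\<close>

lemma mem_seg:
  assumes xy: "norm x \<le> 1" "norm y \<le> 1" "norm z \<le> 1"
  shows "z \<in> seg x y \<longleftrightarrow> d x z + d z y = d x y"
proof
  assume "z \<in> seg x y"
  then obtain t where t: "t \<in> {0..1}" "z = c x y t" by (auto simp: seg_def)
  then have "d x z = t * d x y" "d z y = (1 - t) * d x y"
    using geodesic_dist[OF xy(1,2), of 0 t] geodesic_dist[OF xy(1,2), of t 1] geodesic_ends[OF xy(1,2)] by auto
  then show "d x z + d z y = d x y" by (simp add: algebra_simps)
next
  assume z: "d x z + d z y = d x y"
  show "z \<in> seg x y"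
  proof (cases "0 < d x z \<and> 0 < d z y")
    case False
    then have "z = x \<or> z = y" using dist_zero xy by (metis not_less)
    then show ?thesis using seg_ends xy by blast
  next
    case True
    define g where "g = (\<lambda>t. if t * d x y \<le> d x z then c x z (t * d x y / d x z)
                           else c z y ((t * d x y - d x z) / d z y))"
    have "geodesic_path g x y"
      using geodesic_path_split[OF xy z] True by (simp add: g_def)
    then have "geodesic_segment (g ` {0..1}) x y" by (auto simp: geodesic_segment_def)
    then have "g ` {0..1} = seg x y"
      using geodesic_segment_seg xy uniquely_geodesic unfolding uniquely_geodesic_def by (metis mem_cball_0)
    moreover have "d x y > 0" using True z by linarith
    then have "g (d x z / d x y) = z" using True xy by (simp add: g_def geodesic_ends)
    moreover have "d x z / d x y \<in> {0..1}" using True z \<open>d x y > 0\<close> by simp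
    ultimately show ?thesis by (metis imageI)
  qed
qed

lemma seg_sym: "\<lbrakk>norm x \<le> 1; norm y \<le> 1\<rbrakk> \<Longrightarrow> seg x y = seg y x"
  using mem_seg[of x y] mem_seg[of y x] seg_in_disc[of x y] seg_in_disc[of y x]
  by (metis (no_types, opaque_lifting) add.commute commute subsetI subset_antisym)

lemma seg_refl:
  assumes "norm x \<le> 1"
  shows "seg x x = {x}"
proof -
  have "z = x" if "z \<in> seg x x" for z
  proof (rule dist_zero)
    have "norm z \<le> 1" using that assms seg_in_disc by blast
    moreover have "d x x = 0" using assms by simp
    ultimately show "d z x \<le> 0" "norm z \<le> 1" "norm x \<le> 1"
      using that assms mem_seg[of x x z] commute[of x z] by auto
  qed
  then show ?thesis using seg_ends assms by blast
qed

lemma seg_subset: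
  assumes "norm x \<le> 1" "norm y \<le> 1" "z \<in> seg x y"
  shows "seg x z \<subseteq> seg x y" "seg z y \<subseteq> seg x y"
proof -
  have z: "norm z \<le> 1" "d x z + d z y = d x y" using assms seg_in_disc mem_seg by blast+
  show "seg x z \<subseteq> seg x y"
  proof
    fix w assume w: "w \<in> seg x z"
    then have wn: "norm w \<le> 1" using assms z seg_in_disc by blast
    then have "d x w + d w z = d x z" using w assms z mem_seg by blast
    then show "w \<in> seg x y"
      using tri[of w z y] tri[of x w y] mem_seg[of x y w] assms z wn by linarith
  qed
  show "seg z y \<subseteq> seg x y"
  proof
    fix w assume w: "w \<in> seg z y"
    then have wn: "norm w \<le> 1" using assms z seg_in_disc by blast
    then have "d z w + d w y = d z y" using w assms z mem_seg by blast
    then show "w \<in> seg x y"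
      using tri[of x z w] tri[of x w y] mem_seg[of x y w] assms z wn by linarith
  qed
qed

lemma seg_cases:
  assumes "norm x \<le> 1" "norm y \<le> 1" "z \<in> seg x y" "w \<in> seg x y"
  shows "w \<in> seg x z \<or> w \<in> seg z y"
proof -
  obtain s t where st: "s \<in> {0..1}" "t \<in> {0..1}" "z = c x y s" "w = c x y t"
    using assms by (auto simp: seg_def)
  have n: "norm z \<le> 1" "norm w \<le> 1" using assms seg_in_disc by blast+
  have dz: "d x z = s * d x y" "d z y = (1 - s) * d x y" "d x w = t * d x y" "d w y = (1 - t) * d x y"
    using geodesic_dist[OF assms(1,2), of 0 s] geodesic_dist[OF assms(1,2), of s 1]
      geodesic_dist[OF assms(1,2), of 0 t] geodesic_dist[OF assms(1,2), of t 1]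
      geodesic_ends[OF assms(1,2)] st by auto
  have zw: "d z w = \<bar>s - t\<bar> * d x y" "d w z = \<bar>t - s\<bar> * d x y"
    using geodesic_dist[OF assms(1,2)] st by auto
  show ?thesis
    using mem_seg[OF assms(1) n] mem_seg[OF n(1) assms(2) n(2)] dz zw by (cases "t \<le> s") (auto simp: algebra_simps)
qed

lemma seg_order:
  assumes "norm x \<le> 1" "norm y \<le> 1" "z \<in> seg x y" "w \<in> seg z y"
  shows "z \<in> seg x w"
proof -
  have z: "norm z \<le> 1" "d x z + d z y = d x y" using assms seg_in_disc mem_seg by blast+
  then have wn: "norm w \<le> 1" using assms seg_in_disc by blast
  then have w: "d z w + d w y = d z y" using assms z mem_seg by blast
  then show ?thesis
    using tri[of x w y] tri[of x z w] mem_seg[of x w z] assms z wn by linarith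
qed

lemma seg_Int:
  assumes "norm x \<le> 1" "norm y \<le> 1" "z \<in> seg x y"
  shows "seg z x \<inter> seg z y = {z}"
proof -
  have z: "norm z \<le> 1" "d x z + d z y = d x y" using assms seg_in_disc mem_seg by blast+
  have "w = z" if w: "w \<in> seg z x" "w \<in> seg z y" for w
  proof -
    have wn: "norm w \<le> 1" using w assms z seg_in_disc by blast
    have "d z w + d w x = d z x" "d z w + d w y = d z y" using w assms z wn mem_seg by blast+
    then have "d z w \<le> 0" using tri[of x w y] z wn assms commute[of x w] commute[of z x] by linarith
    then show ?thesis using dist_zero z wn by blast
  qed
  then show ?thesis using seg_ends z assms by blast
qed

lemma seg_Un:
  assumes "norm x \<le> 1" "norm y \<le> 1" "z \<in> seg x y"
  shows "seg z x \<union> seg z y = seg x y"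
proof -
  have "seg z x = seg x z" using assms seg_in_disc seg_sym by blast
  then show ?thesis using seg_subset[OF assms] seg_cases[OF assms] by auto
qed

section \<open>Continuity and compactness of families of geodesics\<close>

lemma cont_geodesic_compose:
  assumes "continuous_on S g" "continuous_on S h" "continuous_on S k"
    and "\<And>x. x \<in> S \<Longrightarrow> norm (g x) \<le> 1" "\<And>x. x \<in> S \<Longrightarrow> norm (h x) \<le> 1" "\<And>x. x \<in> S \<Longrightarrow> k x \<in> {0..1::real}"
  shows "continuous_on S (\<lambda>x. c (g x) (h x) (k x))"
proof -
  have a: "continuous_on S (\<lambda>x. ((g x, h x), k x))"
    by (rule continuous_on_Pair[OF continuous_on_Pair[OF assms(1,2)] assms(3)])
  have b: "((g x, h x), k x) \<in> (cball 0 1 \<times> cball 0 1) \<times> {0..1}" if "x \<in> S" for x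
    using assms(4-6)[OF that] by simp
  have "continuous_on S ((\<lambda>((x, y), t). c x y t) \<circ> (\<lambda>x. ((g x, h x), k x)))"
    by (rule continuous_on_compose[OF a continuous_on_subset[OF cont_geodesic]]) (use b in blast)
  then show ?thesis by (simp add: o_def)
qed

lemma continuous_on_geodesic:
  assumes "norm x \<le> 1" "norm y \<le> 1"
  shows "continuous_on {0..1} (c x y)"
  by (rule cont_geodesic_compose[of "{0..1}" "\<lambda>_. x" "\<lambda>_. y" "\<lambda>t. t"]) (use assms in simp_all)

lemma compact_seg: "\<lbrakk>norm x \<le> 1; norm y \<le> 1\<rbrakk> \<Longrightarrow> compact (seg x y)"
  unfolding seg_def by (rule compact_continuous_image[OF continuous_on_geodesic]) auto

lemma connected_seg: "\<lbrakk>norm x \<le> 1; norm y \<le> 1\<rbrakk> \<Longrightarrow> connected (seg x y)"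
  unfolding seg_def by (rule connected_continuous_image[OF continuous_on_geodesic]) auto

lemma compact_Union_seg:
  assumes "compact Q" "Q \<subseteq> cball 0 1" "norm v \<le> 1"
  shows "compact (\<Union>q\<in>Q. seg v q)"
proof -
  have "compact ((\<lambda>(q, t). c v q t) ` (Q \<times> {0..1}))"
    unfolding case_prod_unfold
    using assms by (intro compact_continuous_image cont_geodesic_compose continuous_intros compact_Times) auto
  moreover have "(\<lambda>(q, t). c v q t) ` (Q \<times> {0..1}) = (\<Union>q\<in>Q. seg v q)"
    by (auto simp: seg_def)
  ultimately show ?thesis by simp
qed

lemma compact_seg_meets:
  assumes "compact Q" "Q \<subseteq> cball 0 1" "norm v \<le> 1" "closed C"
  shows "compact {q \<in> Q. seg v q \<inter> C \<noteq> {}}"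
proof -
  have "continuous_on (Q \<times> {0..1::real}) (\<lambda>z. c v (fst z) (snd z))"
    using assms by (intro cont_geodesic_compose continuous_intros) auto
  then have "closedin (top_of_set (Q \<times> {0..1})) ((Q \<times> {0..1}) \<inter> (\<lambda>z. c v (fst z) (snd z)) -` C)"
    using assms(4) by (rule continuous_closedin_preimage)
  then have "compact ((Q \<times> {0..1}) \<inter> (\<lambda>z. c v (fst z) (snd z)) -` C)"
    by (rule closedin_compact[rotated]) (simp add: assms(1) compact_Times)
  then have "compact (fst ` ((Q \<times> {0..1}) \<inter> (\<lambda>z. c v (fst z) (snd z)) -` C))"
    by (intro compact_continuous_image continuous_intros)
  moreover have "fst ` ((Q \<times> {0..1}) \<inter> (\<lambda>z. c v (fst z) (snd z)) -` C) = {q \<in> Q. seg v q \<inter> C \<noteq> {}}"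
    by (force simp: seg_def)
  ultimately show ?thesis by simp
qed

text \<open>Geodesics are prolonged beyond the boundary circle by radial rays, so that the boundary of the
  disc needs no separate treatment even where geodesics touch it.\<close>

definition ray :: "complex \<Rightarrow> complex set" where
  "ray q = {t *\<^sub>R q |t. 1 \<le> t}"

definition long :: "complex \<Rightarrow> complex \<Rightarrow> complex set" where
  "long v q = seg v q \<union> ray q"

lemma mem_ray:
  assumes "norm q = 1"
  shows "z \<in> ray q \<longleftrightarrow> 1 \<le> norm z \<and> z /\<^sub>R norm z = q"
proof
  assume "z \<in> ray q"
  then obtain t where "1 \<le> t" "z = t *\<^sub>R q" by (auto simp: ray_def)
  then show "1 \<le> norm z \<and> z /\<^sub>R norm z = q" using assms by simp
next
  assume z: "1 \<le> norm z \<and> z /\<^sub>R norm z = q"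
  then have "z = norm z *\<^sub>R q" by (metis divideR_right norm_zero not_one_le_zero)
  then show "z \<in> ray q" unfolding ray_def using z by blast
qed

lemma mem_ray_self: "q \<in> ray q"
  unfolding ray_def by (force intro: exI[of _ 1])

lemma ray_Int_disc: "norm q = 1 \<Longrightarrow> z \<in> ray q \<Longrightarrow> norm z \<le> 1 \<Longrightarrow> z = q"
  by (metis mem_ray inverse_1 nle_le scaleR_one)

lemma closed_Union_ray:
  assumes "compact Q" "Q \<subseteq> sphere 0 1"
  shows "closed (\<Union>q\<in>Q. ray q)"
proof -
  have "closed ((- ball 0 1) \<inter> (\<lambda>z::complex. z /\<^sub>R norm z) -` Q)"
    using assms by (intro continuous_closed_preimage continuous_intros compact_imp_closed) auto
  moreover have "(- ball 0 1) \<inter> (\<lambda>z::complex. z /\<^sub>R norm z) -` Q = (\<Union>q\<in>Q. ray q)"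
    using assms mem_ray by (force simp: subset_iff)
  ultimately show ?thesis by simp
qed

lemma closed_Union_long:
  assumes "compact Q" "Q \<subseteq> sphere 0 1" "norm v \<le> 1"
  shows "closed (\<Union>q\<in>Q. long v q)"
proof -
  have "Q \<subseteq> cball 0 1" using assms by auto
  then have "closed ((\<Union>q\<in>Q. seg v q) \<union> (\<Union>q\<in>Q. ray q))"
    using assms closed_Union_ray compact_Union_seg compact_imp_closed by blast
  moreover have "(\<Union>q\<in>Q. seg v q) \<union> (\<Union>q\<in>Q. ray q) = (\<Union>q\<in>Q. long v q)" by (auto simp: long_def)
  ultimately show ?thesis by simp
qed

lemma closed_long: "\<lbrakk>norm q = 1; norm v \<le> 1\<rbrakk> \<Longrightarrow> closed (long v q)"
  using closed_Union_long[of "{q}" v] by simp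

text \<open>Radial projection replaces the unbounded rays by compact data: the rays that meet
  \<open>C\<close> are those in the directions of the points of \<open>C\<close> outside the open
  disc. Hence avoiding \<open>C\<close> is an open condition on \<open>q\<close>.\<close>

lemma compact_long_meets:
  assumes "compact C" "norm v \<le> 1"
  shows "compact {q \<in> sphere 0 1. long v q \<inter> C \<noteq> {}}"
proof -
  have "compact ((\<lambda>z::complex. z /\<^sub>R norm z) ` (C - ball 0 1))"
    using assms by (intro compact_continuous_image continuous_intros compact_diff) auto
  moreover have "compact {q \<in> sphere 0 1. seg v q \<inter> C \<noteq> {}}"
    by (rule compact_seg_meets) (use assms compact_imp_closed in auto)
  moreover have "(\<lambda>z::complex. z /\<^sub>R norm z) ` (C - ball 0 1) \<union> {q \<in> sphere 0 1. seg v q \<inter> C \<noteq> {}}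
      = {q \<in> sphere 0 1. long v q \<inter> C \<noteq> {}}" (is "?L = ?R")
  proof
    show "?L \<subseteq> ?R"
    proof (intro Un_least subsetI)
      fix q assume "q \<in> (\<lambda>z::complex. z /\<^sub>R norm z) ` (C - ball 0 1)"
      then obtain z where z: "z \<in> C" "1 \<le> norm z" "q = z /\<^sub>R norm z" by (auto simp: not_less)
      then have "norm z \<noteq> 0" by linarith
      then have "norm q = 1" using z(3) by simp
      then show "q \<in> ?R" using z mem_ray[of q z] by (auto simp: long_def)
    qed (auto simp: long_def)
    show "?R \<subseteq> ?L"
    proof
      fix q assume "q \<in> ?R"
      then obtain z where q: "norm q = 1" "z \<in> C" "z \<in> seg v q \<or> z \<in> ray q" by (auto simp: long_def)
      then show "q \<in> ?L"
        using mem_ray[of q z] by (auto intro!: image_eqI[of _ _ z])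
    qed
  qed
  ultimately show ?thesis using compact_Un by fastforce
qed

lemma compact_opposite:
  assumes "norm v \<le> 1"
  shows "compact {(p, q). norm p = 1 \<and> norm q = 1 \<and> v \<in> seg p q}"
proof -
  let ?T = "(sphere 0 1 \<times> sphere 0 1) \<times> {0..1::real}"
  let ?g = "\<lambda>z::(complex\<times>complex)\<times>real. c (fst (fst z)) (snd (fst z)) (snd z)"
  have "continuous_on ?T ?g" by (intro cont_geodesic_compose continuous_intros) auto
  then have "closedin (top_of_set ?T) (?T \<inter> ?g -` {v})"
    by (rule continuous_closedin_preimage) simp
  then have "compact (?T \<inter> ?g -` {v})"
    by (rule closedin_compact[rotated]) (simp add: compact_Times)
  then have "compact (fst ` (?T \<inter> ?g -` {v}))"
    by (intro compact_continuous_image continuous_intros)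
  moreover have "fst ` (?T \<inter> ?g -` {v}) = {(p, q). norm p = 1 \<and> norm q = 1 \<and> v \<in> seg p q}"
    by (force simp: seg_def)
  ultimately show ?thesis by simp
qed

text \<open>If all geodesics from \<open>p\<close> to the circle missed \<open>w\<close>, moving
  along them back to \<open>p\<close> and retracting the punctured plane onto the circle would
  contract the circle in itself.\<close>

lemma exists_seg_through:
  assumes p: "norm p = 1" and w: "norm w \<le> 1"
  shows "\<exists>q. norm q = 1 \<and> w \<in> seg p q"
proof (cases "norm w = 1")
  case True
  then show ?thesis using seg_ends[of p w] p by auto
next
  case False
  then have w1: "w \<in> ball 0 1" using w by simp
  show ?thesis
  proof (rule ccontr)
    assume "\<not> ?thesis"
    then have no: "w \<notin> seg p q" if "norm q = 1" for q using that by blast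
    have "sphere 0 1 retract_of (- {w})"
      using rel_frontier_retract_of_punctured_affine_hull[of "cball 0 1" w] w1
      by (simp add: rel_interior_nonempty_interior rel_frontier_nonempty_interior Compl_eq_Diff_UNIV
          affine_hull_nonempty_interior)
    then obtain r where r: "continuous_on (- {w}) r" "r ` (- {w}) \<subseteq> sphere 0 1" "\<And>x. x \<in> sphere 0 1 \<Longrightarrow> r x = x"
      unfolding retract_of_def retraction_def by (metis image_subset_iff_funcset)
    let ?h = "\<lambda>z. r (c p (snd z) (1 - fst z))"
    have avoid: "c p q t \<noteq> w" if "norm q = 1" "t \<in> {0..1}" for q t
      using no[OF that(1)] that(2) by (auto simp: seg_def)
    have "continuous_on ({0..1::real} \<times> sphere 0 1) (\<lambda>z. c p (snd z) (1 - fst z))"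
      using p by (intro cont_geodesic_compose continuous_intros) auto
    then have "continuous_on ({0..1::real} \<times> sphere 0 1) ?h"
    proof (rule continuous_on_compose2[OF r(1)])
      show "(\<lambda>z. c p (snd z) (1 - fst z)) ` ({0..1::real} \<times> sphere 0 1) \<subseteq> - {w}"
      proof
        fix y assume "y \<in> (\<lambda>z. c p (snd z) (1 - fst z)) ` ({0..1::real} \<times> sphere 0 1)"
        then obtain t q where "t \<in> {0..1}" "norm q = 1" "y = c p q (1 - t)" by auto
        then show "y \<in> - {w}" using avoid[of q "1 - t"] by simp
      qed
    qed
    moreover have "?h ` ({0..1} \<times> sphere 0 1) \<subseteq> sphere 0 1"
    proof
      fix y assume "y \<in> ?h ` ({0..1} \<times> sphere 0 1)"
      then obtain t q where tq: "t \<in> {0..1}" "norm q = 1" "y = r (c p q (1 - t))" by auto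
      then have "c p q (1 - t) \<in> - {w}" using avoid by simp
      then show "y \<in> sphere 0 1" using r(2) tq(3) by blast
    qed
    moreover have "?h (0, x) = x" "?h (1, x) = p" if "x \<in> sphere 0 1" for x
      using that p r(3) by (simp_all add: geodesic_ends)
    ultimately have "homotopic_with_canon (\<lambda>h. True) (sphere 0 1) (sphere 0 1) id (\<lambda>_. p)"
      by (subst homotopic_with) (auto intro!: exI[of _ ?h] simp: image_subset_iff_funcset)
    then have "contractible (sphere (0::complex) 1)" unfolding contractible_def by blast
    then show False by (simp add: contractible_sphere)
  qed
qed

end


subsection \<open>Geodesics from a boundary point\<close>

definition circ :: "complex \<Rightarrow> real \<Rightarrow> complex" where
  "circ p t = p * cis (2 * pi * t)"

lemma norm_circ [simp]: "norm (circ p t) = norm p"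
  by (simp add: circ_def norm_mult)

lemma circ_0 [simp]: "circ p 0 = p" and circ_1 [simp]: "circ p 1 = p"
  by (simp_all add: circ_def)

lemma continuous_on_circ: "continuous_on S (circ p)"
  unfolding circ_def by (intro continuous_intros)

lemma circ_eq_iff:
  assumes "p \<noteq> 0" "s \<in> {0..1}" "t \<in> {0..1}"
  shows "circ p s = circ p t \<longleftrightarrow> s = t \<or> {s, t} = {0, 1}"
proof
  assume "circ p s = circ p t"
  then have "cis (2 * pi * s) = cis (2 * pi * t)" using assms by (simp add: circ_def)
  then have "cis (2 * pi * s) / cis (2 * pi * t) = 1" by simp
  then have "cis (2 * pi * s - 2 * pi * t) = 1" by (simp add: cis_divide)
  then have "cos (2 * pi * s - 2 * pi * t) = 1" by (metis cis.sel(1) one_complex.sel(1))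
  then obtain n :: int where "2 * pi * s - 2 * pi * t = of_int n * (2 * pi)"
    by (auto simp: cos_one_2pi_int)
  then have "(2 * pi) * (s - t) = (2 * pi) * of_int n" by (simp add: algebra_simps)
  then have "s - t = of_int n" by (simp only: mult_cancel_left) simp
  moreover have "-1 \<le> s - t" "s - t \<le> 1" using assms by auto
  ultimately have "n = -1 \<or> n = 0 \<or> n = 1" by linarith
  then show "s = t \<or> {s, t} = {0, 1}" using \<open>s - t = of_int n\<close> assms by auto
qed (auto simp: doubleton_eq_iff)

lemma circ_surj:
  assumes "norm p = 1" "norm q = 1"
  shows "\<exists>t\<in>{0..1}. q = circ p t"
proof -
  have p: "p \<noteq> 0" using assms by auto
  have "norm (q / p) = 1" using assms by (simp add: norm_divide)
  then have "q / p = cis (Arg2pi (q / p))"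
    by (metis Arg2pi_eq cis_conv_exp mult_1 of_real_1 mult.commute)
  then have "q = circ p (Arg2pi (q / p) / (2 * pi))"
    using p by (simp add: circ_def field_simps)
  moreover have "Arg2pi (q / p) / (2 * pi) \<in> {0..1}"
    using Arg2pi_ge_0[of "q/p"] Arg2pi_lt_2pi[of "q/p"] by (simp add: field_simps)
  ultimately show ?thesis by blast
qed

context geodesic_disc
begin

text \<open>The ray from \<open>w\<close> through \<open>q\<close> escapes to infinity without meeting the loop formed by the
  prolonged geodesic from \<open>p\<close> to \<open>b\<close> and the arc \<open>g\<close>.\<close>

lemma winding_number_geodesic_loop:
  assumes n: "norm p = 1" "norm b = 1" "norm q = 1" and w: "norm w \<le> 1" "w \<in> seg p q" "w \<notin> seg p b"
    and g: "path g" "pathstart g = 2 * b" "pathfinish g = 2 * p" "path_image g \<subseteq> sphere 0 2"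
      "2 * q \<notin> path_image g"
  defines "k \<equiv> linepath (2 * p) p +++ c p b +++ linepath b (2 * b)"
  shows "winding_number k w + winding_number g w = 0"
proof -
  have nle: "norm p \<le> 1" "norm b \<le> 1" "norm q \<le> 1" using n by auto
  note ends = geodesic_ends[OF nle(1,2)]
  have pc: "path (c p b)" "pathstart (c p b) = p" "pathfinish (c p b) = b" "path_image (c p b) = seg p b"
    using continuous_on_geodesic[OF nle(1,2)] ends
    by (auto simp: path_def pathstart_def pathfinish_def path_image_def seg_def)
  have k: "path k" "pathstart k = 2 * p" "pathfinish k = 2 * b"
    using pc by (auto simp: k_def)
  have ki: "path_image k = closed_segment (2 * p) p \<union> seg p b \<union> closed_segment b (2 * b)"
    using pc by (simp add: k_def path_image_join Un_assoc)
  have sub_ray: "closed_segment a (2 * a) \<subseteq> ray a \<inter> cball 0 2" if "norm a = 1" for a :: complex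
  proof
    fix z assume "z \<in> closed_segment a (2 * a)"
    then obtain u where u: "0 \<le> u" "u \<le> 1" "z = (1 - u) *\<^sub>R a + u *\<^sub>R (2 * a)" by (auto simp: in_segment)
    then have z: "z = (1 + u) *\<^sub>R a" by (simp add: scaleR_conv_of_real algebra_simps)
    then show "z \<in> ray a \<inter> cball 0 2" using u that by (auto simp: ray_def)
  qed
  have ki2: "path_image k \<subseteq> ray p \<union> seg p b \<union> ray b"
    using ki sub_ray[OF n(1)] sub_ray[OF n(2)] closed_segment_commute[of p "2 * p"] by auto
  have ki3: "path_image k \<subseteq> cball 0 2"
    using ki sub_ray[OF n(1)] sub_ray[OF n(2)] closed_segment_commute[of p "2 * p"] seg_in_disc[OF nle(1,2)]
    by (force simp: subset_iff)
  have qp: "q \<noteq> p" using w(2,3) seg_refl seg_ends nle by auto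
  have qb: "q \<noteq> b" using w by auto
  have pwq: "p \<notin> seg w q"
  proof
    assume "p \<in> seg w q"
    then have "d w p + d p q = d w q" "d p w + d w q = d p q"
      using mem_seg[OF w(1) nle(3,1)] mem_seg[OF nle(1,3) w(1)] w by auto
    then have "d p w \<le> 0" using commute[of w p] by linarith
    then show False using dist_zero[OF nle(1) w(1)] w(3) seg_ends nle by auto
  qed
  \<comment> \<open>Otherwise \<open>w\<close> would lie between \<open>p\<close> and
    \<open>z\<close>, hence on \<open>[p, b]\<close>.\<close>
  have bwq: "z \<notin> seg w q" if "z \<in> seg p b" for z
  proof
    assume "z \<in> seg w q"
    then have "w \<in> seg p z" using seg_order[OF nle(1,3) w(2)] by blast
    then show False using seg_subset(1)[OF nle(1,2) that] w(3) by blast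
  qed
  have rays: "ray a \<inter> ray q = {}" if "a \<noteq> q" "norm a = 1" for a
    using mem_ray[OF that(2)] mem_ray[OF n(3)] that(1) by auto
  have segray: "seg w q \<inter> ray a \<subseteq> {a}" if "norm a = 1" for a
    using ray_Int_disc[OF that] seg_in_disc[OF w(1) nle(3)] by auto
  have b: "b \<in> seg p b" using seg_ends nle by blast
  have "q \<notin> seg p b" using seg_subset(1)[OF nle(1,2), of q] w by blast
  then have "seg p b \<inter> ray q = {}"
    using ray_Int_disc[OF n(3)] seg_in_disc[OF nle(1,2)] by blast
  then have disj1: "long w q \<inter> path_image k = {}"
    using ki2 rays[OF qp[symmetric] n(1)] rays[OF qb[symmetric] n(2)] segray[OF n(1)] segray[OF n(2)] pwq bwq b
    unfolding long_def by blast
  have disj2: "long w q \<inter> path_image g = {}"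
  proof -
    have "z = 2 * q" if "z \<in> long w q" "norm z = 2" for z
    proof -
      have "z \<in> ray q" using that seg_in_disc[OF w(1) nle(3), of z] by (auto simp: long_def)
      then show ?thesis using mem_ray[OF n(3)] that by (force simp: scaleR_conv_of_real)
    qed
    then show ?thesis using g(4,5) by (auto simp: subset_iff)
  qed
  have wl: "w \<in> long w q" using seg_ends w nle by (auto simp: long_def)
  let ?L = "k +++ g"
  have L: "path ?L" "pathfinish ?L = pathstart ?L" "path_image ?L = path_image k \<union> path_image g"
    using k g by (auto simp: path_image_join)
  have conn: "connected (long w q)"
  proof -
    have "connected (ray q)"
    proof -
      have "connected ((\<lambda>t. t *\<^sub>R q) ` {1..})"
        by (intro connected_continuous_image continuous_intros) auto
      moreover have "(\<lambda>t. t *\<^sub>R q) ` {1..} = ray q" by (auto simp: ray_def)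
      ultimately show ?thesis by simp
    qed
    moreover have "q \<in> seg w q" "q \<in> ray q" using seg_ends w nle mem_ray_self by auto
    ultimately show ?thesis
      unfolding long_def using connected_seg[OF w(1) nle(3)] by (intro connected_Un) auto
  qed
  \<comment> \<open>The loop stays in the disc of radius 2, so its winding number about
    \<open>3 * q\<close> vanishes.\<close>
  have q3: "3 * q \<in> long w q" unfolding long_def ray_def
    by (rule UnI2) (auto intro!: exI[of _ 3] simp: scaleR_conv_of_real)
  have "winding_number ?L w = winding_number ?L (3 * q)"
    by (rule winding_number_eq[OF L(1,2) wl q3 conn]) (use disj1 disj2 L(3) in blast)
  also have "\<dots> = 0"
    by (rule winding_number_zero_outside[OF L(1), of "cball 0 2"])
      (use L g ki3 n in \<open>auto simp: norm_mult\<close>)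
  finally show "winding_number k w + winding_number g w = 0"
    using winding_number_join[OF k(1) _ g(1), of w] k(3) g(2) disj1 disj2 wl by auto
qed

text \<open>If \<open>w\<close> were off \<open>[p, circ p t]\<close>, this prolonged geodesic could
  be closed by either of two arcs of the circle of radius 2. Both loops have winding number 0 about
  \<open>w\<close>, which escapes through \<open>circ p s\<close> or \<open>circ p u\<close>.
  Together the arcs form the whole circle, whose winding number about \<open>w\<close> is positive.
  Radius 2 keeps the arcs away from geodesics that touch the unit circle.\<close>

lemma seg_circ_between:
  assumes p: "norm p = 1" and w: "w \<in> seg p (circ p s)" "w \<in> seg p (circ p u)"
    and st: "0 \<le> s" "s \<le> t" "t \<le> u" "u \<le> 1"
  shows "w \<in> seg p (circ p t)"
proof (rule ccontr)
  assume not: "w \<notin> seg p (circ p t)"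
  have p0: "p \<noteq> 0" using p by auto
  have wn: "norm w \<le> 1" using seg_in_disc[OF _ _ w(1)] p by simp
  have end1: "w \<noteq> p" using not seg_ends[of p "circ p t"] p by auto
  have "seg p (circ p 0) = {p}" "seg p (circ p 1) = {p}" using seg_refl[of p] p by simp_all
  then have "s \<noteq> 0" "u \<noteq> 1" using end1 w by (metis singletonD)+
  moreover have "s \<noteq> t" "u \<noteq> t" using not w by metis+
  ultimately have lt: "0 < s" "s < t" "t < u" "u < 1" using st by auto
  define \<gamma> where "\<gamma> = (\<lambda>x. 2 * circ p x)"
  have \<gamma>: "path \<gamma>" "\<gamma> 0 = 2 * p" "\<gamma> 1 = 2 * p" "path_image \<gamma> \<subseteq> sphere 0 2"
    using p by (auto simp: \<gamma>_def path_def path_image_def norm_mult intro!: continuous_intros continuous_on_circ)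
  define k where "k = linepath (2 * p) p +++ c p (circ p t) +++ linepath (circ p t) (2 * circ p t)"
  have t01: "t \<in> {0..1}" using lt by auto
  have im1: "path_image (subpath t 1 \<gamma>) = \<gamma> ` {t..1}" "path_image (subpath 0 t \<gamma>) = \<gamma> ` {0..t}"
    using lt by (simp_all add: path_image_subpath)
  have ne: "\<gamma> x \<noteq> \<gamma> y" if "x \<in> {0..1}" "y \<in> {0<..<1}" "x \<noteq> y" for x y
    using circ_eq_iff[OF p0 that(1), of y] that by (auto simp: \<gamma>_def doubleton_eq_iff)
  have no1: "2 * circ p s \<notin> path_image (subpath t 1 \<gamma>)"
  proof
    assume "2 * circ p s \<in> path_image (subpath t 1 \<gamma>)"
    then have "\<gamma> s \<in> \<gamma> ` {t..1}" unfolding im1 by (simp only: \<gamma>_def)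
    then obtain x where "x \<in> {t..1}" "\<gamma> x = \<gamma> s" by (metis imageE)
    then show False using ne[of x s] lt by simp
  qed
  have no2: "2 * circ p u \<notin> path_image (subpath 0 t \<gamma>)"
  proof
    assume "2 * circ p u \<in> path_image (subpath 0 t \<gamma>)"
    then have "\<gamma> u \<in> \<gamma> ` {0..t}" unfolding im1 by (simp only: \<gamma>_def)
    then obtain x where "x \<in> {0..t}" "\<gamma> x = \<gamma> u" by (metis imageE)
    then show False using ne[of x u] lt by simp
  qed
  have sub: "path_image (subpath t 1 \<gamma>) \<subseteq> sphere 0 2" "path_image (subpath 0 t \<gamma>) \<subseteq> sphere 0 2"
    using \<gamma>(4) path_image_subpath_subset[of _ _ \<gamma>] t01 by (meson atLeastAtMost_iff order_refl zero_le_one subset_trans)+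
  have wnot: "w \<notin> path_image \<gamma>" using \<gamma>(4) wn by auto
  have w1: "winding_number k w + winding_number (subpath t 1 \<gamma>) w = 0"
    unfolding k_def
    by (rule winding_number_geodesic_loop[where q = "circ p s"])
      (use p wn w not \<gamma> t01 sub no1 in \<open>auto simp: pathstart_subpath pathfinish_subpath \<gamma>_def path_subpath\<close>)
  have w2: "winding_number k w + winding_number (reversepath (subpath 0 t \<gamma>)) w = 0"
    unfolding k_def
    by (rule winding_number_geodesic_loop[where q = "circ p u"])
      (use p wn w not \<gamma> t01 sub no2 in \<open>auto simp: pathstart_subpath pathfinish_subpath \<gamma>_def path_subpath\<close>)
  have "w \<notin> path_image (subpath 0 t \<gamma>)" using sub wn by auto
  then have w3: "winding_number (reversepath (subpath 0 t \<gamma>)) w = - winding_number (subpath 0 t \<gamma>) w"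
    using \<gamma>(1) t01 by (intro winding_number_reversepath path_subpath) auto
  have "winding_number (subpath 0 t \<gamma>) w + winding_number (subpath t 1 \<gamma>) w = winding_number (subpath 0 1 \<gamma>) w"
    using \<gamma>(1) wnot t01 by (intro winding_number_subpath_combine) auto
  moreover have "winding_number (subpath t 1 \<gamma>) w = - winding_number k w"
    "winding_number (subpath 0 t \<gamma>) w = winding_number k w"
    using w1 w2 w3 by (simp_all add: eq_neg_iff_add_eq_0 add.commute)
  ultimately have "winding_number \<gamma> w = 0" by simp
  moreover have "\<gamma> = part_circlepath 0 2 (Arg p) (Arg p + 2 * pi)"
  proof
    fix x
    have "p = exp (\<i> * of_real (Arg p))" using Arg_eq[OF p0] p by simp
    then have "2 * (p * exp (\<i> * of_real (2 * pi * x))) = 2 * exp (\<i> * of_real (Arg p + 2 * pi * x))"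
      by (metis exp_add distrib_left of_real_add)
    moreover have "linepath (Arg p) (Arg p + 2 * pi) x = Arg p + 2 * pi * x"
      by (simp add: linepath_def algebra_simps)
    ultimately show "\<gamma> x = part_circlepath 0 2 (Arg p) (Arg p + 2 * pi) x"
      by (simp add: \<gamma>_def circ_def part_circlepath_def cis_conv_exp)
  qed
  moreover have "0 < Re (winding_number (part_circlepath 0 2 (Arg p) (Arg p + 2 * pi)) w)"
    by (rule winding_number_part_circlepath_pos_less) (use wn in auto)
  ultimately show False by simp
qed

end


subsection \<open>Saddle maps\<close>

lemma connected_if_components_unbounded:
  fixes S :: "complex set"
  assumes "bounded (- S)" "\<And>x. x \<in> S \<Longrightarrow> \<not> bounded (connected_component_set S x)"
  shows "connected S"
proof (rule connected_iff_connected_component[THEN iffD2, rule_format])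
  fix x y assume xy: "x \<in> S" "y \<in> S"
  have "connected_component_set S x = connected_component_set S y"
    by (rule cobounded_unique_unbounded_component) (use assms xy in auto)
  then show "connected_component S x y" using xy by (metis connected_component_refl mem_Collect_eq)
qed

lemma nonempty_frontier:
  fixes U :: "complex set"
  assumes "bounded U" "x \<in> U"
  shows "frontier U \<noteq> {}"
  using assms by (metis frontier_eq_empty empty_iff not_bounded_UNIV)

lemma closed_away:
  assumes "closed T" "q \<notin> T"
  shows "\<exists>e>0. \<forall>r. dist r q < e \<longrightarrow> r \<notin> T"
proof -
  have "open (- T)" "q \<in> - T" using assms by (simp_all add: open_Compl)
  then obtain e where "e > 0" "\<forall>r. dist r q < e \<longrightarrow> r \<in> - T" unfolding open_dist by blast
  then show ?thesis by auto
qed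

locale saddle_map = geodesic_disc d c for d c +
  fixes f :: "complex \<Rightarrow> complex"
  assumes cont_f: "continuous_on (cball 0 1) f"
    and f_disc: "norm x \<le> 1 \<Longrightarrow> norm (f x) \<le> 1"
    and f_circle: "norm x = 1 \<Longrightarrow> norm (f x) = 1"
    and f_onto: "norm y = 1 \<Longrightarrow> \<exists>x. norm x = 1 \<and> f x = y"
    and f_fibre: "norm y = 1 \<Longrightarrow> connected {x. norm x = 1 \<and> f x = y}"
    and f_saddle: "\<lbrakk>norm x \<le> 1; norm y \<le> 1; K \<in> components (cball 0 1 - f -` seg x y)\<rbrakk>
      \<Longrightarrow> K \<inter> sphere 0 1 \<noteq> {}"
begin

section \<open>The radial extension and the saddle condition in the plane\<close>

definition F :: "complex \<Rightarrow> complex" where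
  "F z = max 1 (norm z) *\<^sub>R f (z /\<^sub>R max 1 (norm z))"

lemma F_in: "norm z \<le> 1 \<Longrightarrow> F z = f z"
  by (simp add: F_def max_def)

lemma F_out: "1 \<le> norm z \<Longrightarrow> F z = norm z *\<^sub>R f (z /\<^sub>R norm z)"
  by (simp add: F_def max_def)

lemma norm_F_out:
  assumes "1 \<le> norm z"
  shows "norm (F z) = norm z"
proof -
  have "norm z \<noteq> 0" using assms by linarith
  then have "norm (z /\<^sub>R norm z) = 1" by simp
  then show ?thesis using f_circle F_out[OF assms] by simp
qed

lemma norm_F_le: "norm (F z) \<le> 1 \<longleftrightarrow> norm z \<le> 1"
  using norm_F_out[of z] f_disc[of z] F_in[of z] by (cases "norm z \<le> 1") auto

lemma continuous_on_F: "continuous_on S F"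
proof -
  have *: "continuous_on UNIV (\<lambda>z::complex. z /\<^sub>R max 1 (norm z))"
    by (intro continuous_intros) (auto simp: max_def)
  have "norm (z /\<^sub>R max 1 (norm z)) \<le> 1" for z :: complex
  proof -
    have "norm (z /\<^sub>R max 1 (norm z)) = norm z / max 1 (norm z)"
      by (simp add: divide_inverse_commute)
    then show ?thesis by (simp add: divide_le_eq_1 less_max_iff_disj)
  qed
  then have "continuous_on UNIV (\<lambda>z. f (z /\<^sub>R max 1 (norm z)))"
    by (intro continuous_on_compose2[OF cont_f *]) auto
  then have "continuous_on UNIV F"
    unfolding F_def by (intro continuous_intros)
  then show ?thesis using continuous_on_subset by blast
qed

lemma F_scale:
  assumes "1 \<le> norm z" "1 \<le> t"
  shows "F (t *\<^sub>R z) = t *\<^sub>R F z"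
proof -
  have "1 * 1 \<le> t * norm z" using assms by (intro mult_mono) auto
  then have "F (t *\<^sub>R z) = (t * norm z) *\<^sub>R f (t *\<^sub>R z /\<^sub>R (t * norm z))"
    using assms F_out[of "t *\<^sub>R z"] by (simp del: scaleR_scaleR inverse_mult_distrib)
  also have "t *\<^sub>R z /\<^sub>R (t * norm z) = z /\<^sub>R norm z" using assms by simp
  also have "(t * norm z) *\<^sub>R f (z /\<^sub>R norm z) = t *\<^sub>R F z" using F_out[OF assms(1)] by simp
  finally show ?thesis .
qed

lemma closed_vimage_F: "closed S \<Longrightarrow> closed (F -` S)"
  using continuous_on_F[of UNIV] by (simp add: continuous_on_closed_vimage)

text \<open>Outside the disc \<open>F\<close> commutes with scaling and \<open>S\<close> consists of
  rays. If the radial ray from \<open>z\<close> entered the preimage of \<open>S\<close>, scaling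
  back would put \<open>F z\<close> on the same ray of \<open>S\<close>.\<close>

lemma unbounded_outside:
  assumes z: "1 \<le> norm z" "F z \<notin> S" and S: "S \<inter> {w. 1 < norm w} = (\<Union>q\<in>Q. ray q) \<inter> {w. 1 < norm w}"
    and Q: "Q \<subseteq> sphere 0 1" "(\<Union>q\<in>Q. ray q) \<subseteq> S"
  shows "\<not> bounded (connected_component_set (- (F -` S)) z)"
proof -
  define A where "A = (\<lambda>t. t *\<^sub>R z) ` {1..}"
  have "F w \<notin> S" if "w \<in> A" for w
  proof
    assume w: "F w \<in> S"
    obtain t where t: "1 \<le> t" "w = t *\<^sub>R z" using \<open>w \<in> A\<close> by (auto simp: A_def)
    show False
    proof (cases "t = 1")
      case True
      then show False using t w z by simp
    next
      case False
      then have t1: "1 < t" using t by simp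
      have Fz: "1 \<le> norm (F z)" using norm_F_out z by simp
      have Fw: "F w = t *\<^sub>R F z" using F_scale z t by simp
      have "1 * 1 < t * norm (F z)" using t1 Fz by (intro mult_less_le_imp_less) auto
      then have "1 < norm (F w)" using Fw t1 by simp
      then obtain q where q: "q \<in> Q" "F w \<in> ray q" using w S by blast
      then have q1: "norm q = 1" using Q by auto
      then have "F w /\<^sub>R norm (F w) = q" using mem_ray q by blast
      moreover have "F w /\<^sub>R norm (F w) = F z /\<^sub>R norm (F z)" using Fw t1 by simp
      ultimately have "F z \<in> ray q" using mem_ray[OF q1] Fz by simp
      then show False using q Q z by blast
    qed
  qed
  then have "A \<subseteq> - (F -` S)" by blast
  moreover have "connected A" unfolding A_def
    by (intro connected_continuous_image continuous_intros) auto
  moreover have "z \<in> A" by (auto simp: A_def image_iff intro: bexI[of _ 1])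
  ultimately have sub: "A \<subseteq> connected_component_set (- (F -` S)) z" by (intro connected_component_maximal)
  have "\<not> bounded A"
  proof
    assume "bounded A"
    then obtain B where B: "\<And>w. w \<in> A \<Longrightarrow> norm w \<le> B" by (auto simp: bounded_iff)
    have "norm z \<le> B" using B \<open>z \<in> A\<close> by blast
    then have "1 \<le> B + 1" using z by linarith
    then have "norm ((B + 1) *\<^sub>R z) \<le> B" by (intro B) (auto simp: A_def)
    moreover have "(B + 1) * 1 \<le> (B + 1) * norm z" using z \<open>1 \<le> B + 1\<close> by (intro mult_left_mono) auto
    moreover have "norm ((B + 1) *\<^sub>R z) = (B + 1) * norm z" using \<open>1 \<le> B + 1\<close> by simp
    ultimately have "(B + 1) * 1 \<le> B" by (metis order_trans)
    then show False by simp
  qed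
  then show ?thesis using sub bounded_subset by blast
qed

text \<open>The saddle condition leads from \<open>z\<close> to the circle off the preimage of the
  segment, and from there a radial ray escapes. The set \<open>Q\<close> of prolonged points is left
  free: \<open>{}\<close> gives the bare segment, the two endpoints (if on the circle) a line
  prolonged at both ends.\<close>

lemma unbounded_component:
  assumes xy: "norm x \<le> 1" "norm y \<le> 1" and Q: "Q \<subseteq> seg x y \<inter> sphere 0 1"
    and S: "S = seg x y \<union> (\<Union>q\<in>Q. ray q)" and z: "F z \<notin> S"
  shows "\<not> bounded (connected_component_set (- (F -` S)) z)"
proof -
  have seg1: "norm w \<le> 1" if "w \<in> seg x y" for w using seg_in_disc xy that by blast
  have Q1: "norm q = 1" if "q \<in> Q" for q using Q that by auto
  have out: "\<not> bounded (connected_component_set (- (F -` S)) u)" if "1 \<le> norm u" "F u \<notin> S" for u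
    by (rule unbounded_outside[OF that, of Q]) (use S Q seg1 in force)+
  have Sseg: "w \<in> seg x y" if "w \<in> S" "norm w \<le> 1" for w
    using that ray_Int_disc[OF Q1] Q unfolding S by blast
  show ?thesis
  proof (cases "1 \<le> norm z")
    case True
    then show ?thesis using out z by blast
  next
    case False
    let ?D = "cball 0 1 - f -` seg x y"
    have zD: "z \<in> ?D" using z False F_in[of z] S by auto
    then have "connected_component_set ?D z \<in> components ?D" by (auto simp: components_def)
    then obtain u where u: "u \<in> connected_component_set ?D z" "norm u = 1"
      using f_saddle[OF xy] by (metis Int_emptyI mem_sphere_0)
    have "?D \<subseteq> - (F -` S)"
    proof
      fix w assume "w \<in> ?D"
      then have "norm w \<le> 1" "F w \<notin> seg x y" by (simp_all add: F_in)
      then show "w \<in> - (F -` S)" using Sseg[of "F w"] norm_F_le[of w] by blast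
    qed
    then have "u \<in> connected_component_set (- (F -` S)) z"
      using u(1) connected_component_mono by blast
    then have "connected_component_set (- (F -` S)) z = connected_component_set (- (F -` S)) u" "F u \<notin> S"
      using connected_component_eq connected_component_in by (blast, fastforce)
    then show ?thesis using out[of u] u by simp
  qed
qed

text \<open>The clopen part is witnessed by a plane neighbourhood \<open>U\<close> rather than by a
  subset of the preimage of \<open>long v q\<close>. Only \<open>frontier U\<close> has to avoid
  this preimage, so the same \<open>U\<close> serves for all nearby \<open>q\<close>.\<close>

definition detaches :: "complex \<Rightarrow> complex \<Rightarrow> complex set \<Rightarrow> bool" where
  "detaches v q A \<longleftrightarrow>
    (\<exists>U. open U \<and> bounded U \<and> frontier U \<inter> F -` long v q = {} \<and> U \<inter> F -` {v} = A)"

lemma compact_F_frontier: "bounded U \<Longrightarrow> compact (F ` frontier U)"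
  using compact_continuous_image[OF continuous_on_F] compact_frontier_bounded by blast

lemma detaches_nearby:
  assumes "detaches v q A" "norm v \<le> 1"
  obtains e where "e > 0" "\<And>r. \<lbrakk>norm r = 1; dist r q < e\<rbrakk> \<Longrightarrow> detaches v r A"
proof -
  obtain U where U: "open U" "bounded U" "frontier U \<inter> F -` long v q = {}" "U \<inter> F -` {v} = A"
    using assms by (auto simp: detaches_def)
  let ?T = "{q \<in> sphere 0 1. long v q \<inter> F ` frontier U \<noteq> {}}"
  have "closed ?T"
    using compact_long_meets[OF compact_F_frontier] U assms compact_imp_closed by blast
  moreover have "q \<notin> ?T" using U(3) by auto
  ultimately obtain e where e: "e > 0" "\<And>r. dist r q < e \<Longrightarrow> r \<notin> ?T"
    using closed_away[of ?T q] by metis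
  show thesis
  proof
    show "detaches v r A" if "norm r = 1" "dist r q < e" for r
    proof -
      have "frontier U \<inter> F -` long v r = {}" using e(2)[OF that(2)] that(1) by auto
      then show ?thesis using U by (auto simp: detaches_def)
    qed
  qed (rule e)
qed

lemma detaches_sym_diff:
  assumes "detaches v q A" "detaches v q B" "norm v \<le> 1" "norm q = 1"
  shows "detaches v q ((A - B) \<union> (B - A))"
proof -
  obtain U where U: "open U" "bounded U" "frontier U \<inter> F -` long v q = {}" "U \<inter> F -` {v} = A"
    using assms by (auto simp: detaches_def)
  obtain V where V: "open V" "bounded V" "frontier V \<inter> F -` long v q = {}" "V \<inter> F -` {v} = B"
    using assms by (auto simp: detaches_def)
  let ?W = "(U - closure V) \<union> (V - closure U)"
  have v: "v \<in> long v q" using seg_ends[of v q] assms by (simp add: long_def)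
  \<comment> \<open>As \<open>v\<close> lies on \<open>long v q\<close>, the frontiers avoid the
    fibre, so that neighbourhoods and their closures cut out the same part of it.\<close>
  have clU: "closure U \<inter> F -` {v} = A" and clV: "closure V \<inter> F -` {v} = B"
    using U(3,4) V(3,4) v closure_Un_frontier[of U] closure_Un_frontier[of V] by auto
  have 1: "frontier (X - closure Y) \<subseteq> frontier X \<union> frontier Y" for X Y :: "complex set"
  proof -
    have "frontier (closure Y) \<subseteq> frontier Y"
      unfolding frontier_def closure_closure using interior_mono[OF closure_subset] by blast
    then show ?thesis
      unfolding Diff_eq using frontier_Int_subset[of X "- closure Y"] frontier_complement by blast
  qed
  have "frontier ?W \<subseteq> frontier U \<union> frontier V"
    using frontier_Un_subset[of "U - closure V" "V - closure U"] 1[of U V] 1[of V U] by blast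
  then have "frontier ?W \<inter> F -` long v q = {}" using U(3) V(3) by blast
  moreover have "?W \<inter> F -` {v} = (A - B) \<union> (B - A)"
    using clU clV U(4) V(4) by blast
  moreover have "open ?W" "bounded ?W" using U V by (auto intro: bounded_subset)
  ultimately show ?thesis unfolding detaches_def by blast
qed

end

text \<open>The parametrization runs once around the circle, from \<open>p\<close> back to
  \<open>p\<close>. It is kept abstract so that reversing it exchanges \<open>Lo\<close> and
  \<open>Up\<close>, and one-sided arguments are needed only once. The order condition
  \<open>between\<close> is supplied by \<open>seg_circ_between\<close>.\<close>

locale sweep = saddle_map d c f for d c f +
  fixes p :: complex and e :: "real \<Rightarrow> complex"
  assumes norm_e: "t \<in> {0..1} \<Longrightarrow> norm (e t) = 1"
    and e_0: "e 0 = p" and e_1: "e 1 = p"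
    and cont_e: "continuous_on {0..1} e"
    and e_onto: "norm q = 1 \<Longrightarrow> \<exists>t\<in>{0..1}. q = e t"
    and e_inj: "\<lbrakk>s \<in> {0..1}; t \<in> {0..1}; e s = e t\<rbrakk> \<Longrightarrow> s = t \<or> {s, t} = {0, 1}"
    and between: "\<lbrakk>0 \<le> s; s \<le> t; t \<le> u; u \<le> 1; w \<in> seg p (e s); w \<in> seg p (e u)\<rbrakk> \<Longrightarrow> w \<in> seg p (e t)"
begin

definition Lo :: "real \<Rightarrow> complex set" where
  "Lo t = (\<Union>s\<in>{0..t}. long p (e s))"

definition Up :: "real \<Rightarrow> complex set" where
  "Up t = (\<Union>s\<in>{t..1}. long p (e s))"

text \<open>Since \<open>e 0 = e 1 = p\<close>, both \<open>Lo t\<close> and \<open>Up t\<close>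
  contain \<open>ray p\<close>; hence the line has to be prolonged at \<open>p\<close> as
  well.\<close>

definition Line :: "real \<Rightarrow> complex set" where
  "Line t = long p (e t) \<union> ray p"

lemma norm_p: "norm p = 1"
  using norm_e[of 0] e_0 by simp

lemma reverse: "sweep d c f p (\<lambda>t. e (1 - t))"
proof unfold_locales
  show "continuous_on {0..1} (\<lambda>t. e (1 - t))"
    by (rule continuous_on_compose2[OF cont_e]) (auto intro!: continuous_intros)
  show "\<exists>t\<in>{0..1}. q = e (1 - t)" if "norm q = 1" for q
  proof -
    obtain t where "t \<in> {0..1}" "q = e t" using e_onto[OF \<open>norm q = 1\<close>] by blast
    then show ?thesis by (intro bexI[of _ "1 - t"]) auto
  qed
  show "s = t \<or> {s, t} = {0, 1}" if "s \<in> {0..1}" "t \<in> {0..1}" "e (1 - s) = e (1 - t)" for s t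
    using e_inj[of "1 - s" "1 - t"] that by (auto simp: doubleton_eq_iff)
qed (use norm_e e_0 e_1 between[of "1 - _" "1 - _" "1 - _"] in auto)

lemma reverse_sides:
  "sweep.Lo c p (\<lambda>t. e (1 - t)) t = Up (1 - t)" "sweep.Up c p (\<lambda>t. e (1 - t)) t = Lo (1 - t)"
  "sweep.Line c p (\<lambda>t. e (1 - t)) t = Line (1 - t)"
proof -
  have "(\<lambda>s. 1 - s) ` {0..t} = {1 - t..1}" "(\<lambda>s. 1 - s) ` {t..1} = {0..1 - t}" by simp_all
  then show "sweep.Lo c p (\<lambda>t. e (1 - t)) t = Up (1 - t)" "sweep.Up c p (\<lambda>t. e (1 - t)) t = Lo (1 - t)"
    unfolding sweep.Lo_def[OF reverse] sweep.Up_def[OF reverse] Lo_def Up_def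
    by (simp_all only: image_image[of "\<lambda>s. long p (e s)" "\<lambda>s. 1 - s", symmetric])
  show "sweep.Line c p (\<lambda>t. e (1 - t)) t = Line (1 - t)"
    unfolding sweep.Line_def[OF reverse] Line_def ..
qed

lemma closed_Lo:
  assumes "t \<le> 1"
  shows "closed (Lo t)"
proof -
  have "compact (e ` {0..t})" using cont_e assms
    by (intro compact_continuous_image continuous_on_subset[OF cont_e]) auto
  moreover have "e ` {0..t} \<subseteq> sphere 0 1" using norm_e assms by auto
  ultimately have "closed (\<Union>q\<in>e ` {0..t}. long p q)" by (rule closed_Union_long) (simp add: norm_p)
  then show ?thesis by (simp add: Lo_def)
qed

lemma closed_Up: "0 \<le> t \<Longrightarrow> closed (Up t)"
  using sweep.closed_Lo[OF reverse, of "1 - t"] reverse_sides(1)[of "1 - t"] by simp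

lemma Lo_Un_Up: "Lo t \<union> Up t = UNIV"
proof -
  have "\<exists>s\<in>{0..1}. w \<in> long p (e s)" for w
  proof (cases "norm w \<le> 1")
    case True
    then obtain q where "norm q = 1" "w \<in> seg p q" using exists_seg_through norm_p by blast
    then show ?thesis using e_onto unfolding long_def by blast
  next
    case False
    then have "norm w \<noteq> 0" by linarith
    then have q: "norm (w /\<^sub>R norm w) = 1" by simp
    then obtain s where "s \<in> {0..1}" "w /\<^sub>R norm w = e s" using e_onto by blast
    then show ?thesis using mem_ray[OF q, of w] False by (auto simp: long_def)
  qed
  then show ?thesis unfolding Lo_def Up_def by fastforce
qed

lemma long_p: "long p p = ray p"
  using seg_refl[of p] norm_p mem_ray_self[of p] by (auto simp: long_def)

text \<open>Inside the disc this is \<open>between\<close>. Outside, two rays can meet only if their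
  starting points coincide, which by \<open>e_inj\<close> means equal parameters or both points at
  \<open>p\<close>.\<close>

lemma Lo_Int_Up:
  assumes t: "t \<in> {0..1}"
  shows "Lo t \<inter> Up t = Line t"
proof
  show "Line t \<subseteq> Lo t \<inter> Up t"
  proof -
    have "long p (e t) \<subseteq> Lo t" "long p (e t) \<subseteq> Up t" using t by (auto simp: Lo_def Up_def)
    moreover have "long p (e 0) \<subseteq> Lo t" "long p (e 1) \<subseteq> Up t" using t by (auto simp: Lo_def Up_def)
    ultimately show ?thesis using e_0 e_1 long_p by (auto simp: Line_def)
  qed
  show "Lo t \<inter> Up t \<subseteq> Line t"
  proof
    fix w assume "w \<in> Lo t \<inter> Up t"
    then obtain s u where su: "0 \<le> s" "s \<le> t" "t \<le> u" "u \<le> 1" "w \<in> long p (e s)" "w \<in> long p (e u)"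
      by (auto simp: Lo_def Up_def)
    have su1: "s \<in> {0..1}" "u \<in> {0..1}" using su by auto
    have inseg: "w \<in> seg p (e r)" if "w \<in> long p (e r)" "r \<in> {0..1}" "norm w \<le> 1" for r
      using that ray_Int_disc[OF norm_e[OF that(2)] _ that(3)] seg_ends[of p "e r"] norm_e[OF that(2)] norm_p
      by (auto simp: long_def)
    have inray: "w \<in> ray (e r)" if "w \<in> long p (e r)" "r \<in> {0..1}" "\<not> norm w \<le> 1" for r
      using that seg_in_disc[of p "e r" w] norm_e[OF that(2)] norm_p by (auto simp: long_def)
    show "w \<in> Line t"
    proof (cases "norm w \<le> 1")
      case True
      then have "w \<in> seg p (e t)" using between[OF su(1-4)] inseg su su1 by blast
      then show ?thesis by (simp add: Line_def long_def)
    next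
      case False
      then have w: "w \<in> ray (e s)" "w \<in> ray (e u)" using inray su su1 by blast+
      then have "e s = e u" using mem_ray[OF norm_e] su1 by metis
      then consider "s = u" | "{s, u} = {0, 1}" using e_inj su1 by blast
      then show ?thesis
      proof cases
        case 1
        then have "s = t" using su by simp
        then show ?thesis using w by (simp add: Line_def long_def)
      next
        case 2
        then have "e s = p" using e_0 e_1 by (auto simp: doubleton_eq_iff)
        then show ?thesis using w by (simp add: Line_def)
      qed
    qed
  qed
qed

lemma closed_Line: "t \<in> {0..1} \<Longrightarrow> closed (Line t)"
  using closed_Int[OF closed_Lo[of t] closed_Up[of t]] Lo_Int_Up[of t] by simp

lemma Lo_mono: "s \<le> t \<Longrightarrow> Lo s \<subseteq> Lo t"
  by (force simp: Lo_def)

lemma Lo_nearby: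
  assumes C: "compact C" "C \<inter> Lo t = {}" and t: "0 \<le> t" "t \<le> 1"
  obtains \<epsilon> where "\<epsilon> > 0" "\<And>u. \<lbrakk>u \<le> 1; u < t + \<epsilon>\<rbrakk> \<Longrightarrow> C \<inter> Lo u = {}"
proof -
  let ?Q = "{q \<in> sphere 0 1. long p q \<inter> C \<noteq> {}}"
  have "closed ?Q" by (rule compact_imp_closed[OF compact_long_meets[OF C(1)]]) (simp add: norm_p)
  define T where "T = {0..1} \<inter> e -` ?Q"
  have "closed T" unfolding T_def
    by (rule continuous_closed_preimage[OF cont_e]) (use \<open>closed ?Q\<close> in auto)
  moreover have "C \<inter> long p (e t) = {}" using C(2) t by (force simp: Lo_def)
  then have "t \<notin> T" by (auto simp: T_def)
  ultimately obtain \<epsilon> where \<epsilon>: "\<epsilon> > 0" "\<And>s. dist s t < \<epsilon> \<Longrightarrow> s \<notin> T"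
    using closed_away[of T t] by blast
  have "C \<inter> long p (e s) = {}" if s: "0 \<le> s" "s \<le> 1" "s < t + \<epsilon>" for s
  proof (cases "s \<le> t")
    case True
    then show ?thesis using C(2) s by (force simp: Lo_def)
  next
    case False
    then have "dist s t < \<epsilon>" using s by (simp add: dist_real_def)
    then show ?thesis using \<epsilon>(2)[of s] s norm_e[of s] by (auto simp: T_def)
  qed
  then have "C \<inter> Lo u = {}" if "u \<le> 1" "u < t + \<epsilon>" for u
    using that unfolding Lo_def by force
  then show thesis using that \<epsilon>(1) by blast
qed

lemma unbounded_Line:
  assumes t: "t \<in> {0..1}" and z: "F z \<notin> Line t"
  shows "\<not> bounded (connected_component_set (- (F -` Line t)) z)"
proof (rule unbounded_component[where x = p and y = "e t" and Q = "{p, e t}"])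
  show "norm p \<le> 1" "norm (e t) \<le> 1" "{p, e t} \<subseteq> seg p (e t) \<inter> sphere 0 1"
    using norm_p norm_e[OF t] seg_ends[of p "e t"] by auto
  show "Line t = seg p (e t) \<union> (\<Union>q\<in>{p, e t}. ray q)" by (auto simp: Line_def long_def)
qed (rule z)

text \<open>The part \<open>Q\<close> of the preimage of the line inside \<open>U\<close> is compact
  and does not separate the plane. By unicoherence of the plane \<open>U\<close> without
  \<open>Q\<close> is still connected, and its image misses the line.\<close>

lemma two_sides:
  assumes t: "t \<in> {0..1}" and U: "open U" "bounded U" "connected U" "frontier U \<inter> F -` Line t = {}"
  shows "F ` U \<subseteq> Lo t \<or> F ` U \<subseteq> Up t"
proof -
  let ?E = "F -` Line t"
  define Q where "Q = U \<inter> ?E"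
  have clE: "closed ?E" using closed_vimage_F closed_Line t by blast
  have "Q = closure U \<inter> ?E" using U(4) closure_Un_frontier[of U] by (auto simp: Q_def)
  then have clQ: "closed Q" using closed_Int[OF closed_closure clE] by simp
  have bQ: "bounded Q" using U(2) by (simp add: Q_def bounded_Int)
  have unb: "\<not> bounded (connected_component_set (- Q) x)" if x: "x \<notin> Q" for x
  proof
    let ?B = "connected_component_set (- Q) x"
    assume bB: "bounded ?B"
    have xB: "x \<in> ?B" using x by simp
    have oB: "open ?B" using clQ by (simp add: open_connected_component open_Compl)
    show False
    proof (cases "?B \<subseteq> ?E")
      case False
      then obtain y where y: "y \<in> ?B" "F y \<notin> Line t" by auto
      have "- ?E \<subseteq> - Q" by (auto simp: Q_def)
      then have "connected_component_set (- ?E) y \<subseteq> connected_component_set (- Q) y"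
        by (rule connected_component_mono)
      also have "\<dots> = ?B" using y(1) connected_component_eq by metis
      finally show False using unbounded_Line[OF t y(2)] bB bounded_subset by blast
    next
      \<comment> \<open>A bounded component of this kind lies in the closed set
        \<open>?E - U\<close>, whereas its frontier lies in \<open>Q\<close>, which is part of
        \<open>U\<close>.\<close>
      case True
      have "?B \<subseteq> - Q" by (rule connected_component_subset)
      then have BU: "?B \<subseteq> ?E - U" using True by (auto simp: Q_def)
      have "closed (?E - U)" using clE U(1) by (simp add: closed_Diff)
      then have "closure ?B \<subseteq> ?E - U" using BU by (simp add: closure_minimal)
      moreover have "frontier ?B \<subseteq> Q"
        using frontier_of_connected_component_subset[of "- Q" x] frontier_subset_closed[OF clQ] frontier_complement[of Q]
        by blast
      moreover have "frontier ?B \<subseteq> closure ?B" by (simp add: frontier_def)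
      ultimately have "frontier ?B = {}" by (auto simp: Q_def)
      then show False using bB xB by (metis bounded_empty empty_iff frontier_eq_empty not_bounded_UNIV)
    qed
  qed
  have "connected (- Q)" using connected_if_components_unbounded[of "- Q"] bQ unb by simp
  moreover have "U \<union> - Q = UNIV" by (auto simp: Q_def)
  ultimately have "connected (U \<inter> - Q)"
    by (intro open_unicoherent_UNIV U(1,3) open_Compl[OF clQ])
  then have con: "connected (F ` (U \<inter> - Q))" by (intro connected_continuous_image continuous_on_F)
  have "F ` (U \<inter> - Q) \<subseteq> - Line t" by (auto simp: Q_def)
  then have cov: "F ` (U \<inter> - Q) \<subseteq> (- Lo t) \<union> (- Up t)" using Lo_Int_Up[OF t] by blast
  have LU: "(- Lo t) \<inter> (- Up t) \<inter> F ` (U \<inter> - Q) = {}" using Lo_Un_Up[of t] by blast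
  have ops: "open (- Lo t)" "open (- Up t)" using closed_Lo closed_Up t by auto
  have "F ` (U \<inter> - Q) \<inter> - Lo t = {} \<or> F ` (U \<inter> - Q) \<inter> - Up t = {}"
    using connectedD[OF con ops LU cov] by blast
  then have "F ` (U \<inter> - Q) \<subseteq> Lo t \<or> F ` (U \<inter> - Q) \<subseteq> Up t" by blast
  moreover have "F ` Q \<subseteq> Lo t \<inter> Up t" using Lo_Int_Up[OF t] by (auto simp: Q_def)
  moreover have "F ` U = F ` (U \<inter> - Q) \<union> F ` Q" by (auto simp: Q_def)
  ultimately show ?thesis by blast
qed

text \<open>Just past the extremal position, \<open>v\<close> is strictly below the line, while the
  frontier of \<open>U\<close> is still mapped strictly above it. So the frontier would enclose the
  component of \<open>x\<close> in the complement of the preimage of the new line, and this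
  component is unbounded.\<close>

lemma not_above_extremal:
  assumes t: "t \<in> {0..1}" and v: "norm v \<le> 1" "v \<noteq> p" "v \<in> seg p (e t)"
    and extremal: "\<And>u. \<lbrakk>t < u; u \<le> 1\<rbrakk> \<Longrightarrow> v \<notin> seg p (e u)"
    and U: "bounded U" "frontier U \<inter> F -` Line t = {}" "x \<in> U" "F x = v"
  shows "\<not> F ` U \<subseteq> Up t"
proof
  assume up: "F ` U \<subseteq> Up t"
  have "t \<noteq> 1" using v seg_refl[of p] norm_p e_1 by auto
  then have t1: "t < 1" using t by simp
  have "F ` closure U \<subseteq> Up t"
    by (rule image_closure_subset[OF continuous_on_F closed_Up up]) (use t in auto)
  moreover have "frontier U \<subseteq> closure U" by (simp add: frontier_def)
  moreover have "F ` frontier U \<inter> Line t = {}" using U(2) by auto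
  ultimately have "F ` frontier U \<inter> Lo t = {}" using Lo_Int_Up[OF t] by blast
  then obtain \<epsilon> where \<epsilon>: "\<epsilon> > 0" "\<And>u. \<lbrakk>u \<le> 1; u < t + \<epsilon>\<rbrakk> \<Longrightarrow> F ` frontier U \<inter> Lo u = {}"
    using Lo_nearby[OF compact_F_frontier[OF U(1)]] t by (metis atLeastAtMost_iff)
  define u where "u = min 1 (t + \<epsilon> / 2)"
  have u: "u \<le> 1" "u < t + \<epsilon>" "t < u" "u \<in> {0..1}" using \<epsilon> t t1 by (auto simp: u_def min_def)
  have vL: "v \<notin> Line u"
  proof
    assume "v \<in> Line u"
    moreover have "v \<notin> seg p (e u)" using extremal u by blast
    ultimately have "v \<in> ray (e u) \<or> v \<in> ray p" by (auto simp: Line_def long_def)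
    then have "v = e u \<or> v = p" using ray_Int_disc norm_e[OF u(4)] norm_p v(1) by blast
    then show False using \<open>v \<notin> seg p (e u)\<close> v(2) seg_ends[of p "e u"] norm_e[OF u(4)] norm_p by auto
  qed
  let ?Z = "connected_component_set (- (F -` Line u)) x"
  have "\<not> bounded ?Z" using unbounded_Line[OF u(4)] U(4) vL by simp
  then have "?Z - U \<noteq> {}" using U(1) bounded_subset by blast
  moreover have xZ: "x \<in> ?Z" using U(4) vL by simp
  ultimately have "?Z \<inter> frontier U \<noteq> {}"
    using U(3) by (intro connected_Int_frontier connected_connected_component) blast+
  then obtain y where y: "y \<in> ?Z" "y \<in> frontier U" by blast
  have con: "connected (F ` ?Z)" by (intro connected_continuous_image continuous_on_F) simp
  have "?Z \<subseteq> - (F -` Line u)" by (rule connected_component_subset)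
  then have cov: "F ` ?Z \<subseteq> (- Lo u) \<union> (- Up u)" using Lo_Int_Up[OF u(4)] by blast
  have LU: "(- Lo u) \<inter> (- Up u) \<inter> F ` ?Z = {}" using Lo_Un_Up[of u] by blast
  have ops: "open (- Lo u)" "open (- Up u)" using closed_Lo closed_Up u by auto
  have "F y \<in> - Lo u" using \<epsilon>(2)[OF u(1,2)] y by blast
  then have "F y \<in> - Lo u \<inter> F ` ?Z" using y(1) by blast
  moreover have "v \<in> Lo t" using v(3) t by (auto simp: Lo_def long_def)
  then have "v \<in> Lo u" using Lo_mono[of t u] u by auto
  then have "v \<notin> Up u" using vL Lo_Int_Up[OF u(4)] by blast
  then have "F x \<in> - Up u" using U(4) by simp
  then have "F x \<in> - Up u \<inter> F ` ?Z" using xZ by blast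
  ultimately show False
    using connectedD[OF con ops LU cov] by (metis empty_iff)
qed

text \<open>A geodesic from \<open>v\<close> cannot leave \<open>Up t\<close> and return: a point
  \<open>z\<close> outside would lie between \<open>v\<close> and a later point \<open>w\<close> of
  \<open>[p, e t]\<close>, but \<open>[v, w]\<close> is contained in
  \<open>[p, e t]\<close>.\<close>

lemma long_Up:
  assumes t: "t \<in> {0..1}" and v: "v \<in> seg p (e t)" and u: "t \<le> u" "u \<le> 1"
  shows "long v (e u) \<subseteq> Up t"
proof -
  have u1: "u \<in> {0..1}" using t u by auto
  have n: "norm p \<le> 1" "norm (e t) \<le> 1" "norm (e u) \<le> 1" using norm_p norm_e t u1 by auto
  have vn: "norm v \<le> 1" using seg_in_disc n v by blast
  have Leq: "w \<in> seg p (e t)" if "w \<in> Line t" "norm w \<le> 1" for w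
    using that ray_Int_disc[OF norm_e[OF t] _ that(2)] ray_Int_disc[OF norm_p _ that(2)] seg_ends[OF n(1,2)]
    by (auto simp: Line_def long_def)
  have "z \<in> Up t" if z: "z \<in> seg v (e u)" for z
  proof (rule ccontr)
    assume nz: "z \<notin> Up t"
    have zn: "norm z \<le> 1" using seg_in_disc vn n z by blast
    have eu: "e u \<in> Up t" unfolding Up_def long_def
      by (rule UN_I[of u]) (use u mem_ray_self in auto)
    have con: "connected (seg z (e u))" using connected_seg zn n by blast
    have cov: "seg z (e u) \<subseteq> Lo t \<union> Up t" using Lo_Un_Up by blast
    have cl: "closed (Lo t)" "closed (Up t)" using closed_Lo closed_Up t by auto
    have "z \<in> Lo t" using nz Lo_Un_Up by blast
    then have "Lo t \<inter> seg z (e u) \<noteq> {}" "Up t \<inter> seg z (e u) \<noteq> {}" using eu seg_ends[OF zn n(3)] by blast+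
    then obtain w where w: "w \<in> Lo t" "w \<in> Up t" "w \<in> seg z (e u)"
      using con cl cov unfolding connected_closed by (metis Int_emptyI Int_iff inf_commute)
    have wn: "norm w \<le> 1" using seg_in_disc zn n w by blast
    have "w \<in> seg p (e t)" using Leq wn w Lo_Int_Up[OF t] by blast
    moreover have "z \<in> seg v w" using seg_order[OF vn n(3) z w(3)] .
    moreover have "seg v w \<subseteq> seg p (e t)"
    proof -
      consider "w \<in> seg p v" | "w \<in> seg v (e t)" using seg_cases[OF n(1,2) v \<open>w \<in> seg p (e t)\<close>] by blast
      then show ?thesis
      proof cases
        case 1
        have "seg v w = seg w v" using seg_sym vn wn by blast
        also have "\<dots> \<subseteq> seg p v" using seg_subset(2)[OF n(1) vn 1] .
        also have "\<dots> \<subseteq> seg p (e t)" using seg_subset(1)[OF n(1,2) v] .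
        finally show ?thesis .
      next
        case 2
        have "seg v w \<subseteq> seg v (e t)" using seg_subset(1)[OF vn n(2) 2] .
        also have "\<dots> \<subseteq> seg p (e t)" using seg_subset(2)[OF n(1,2) v] .
        finally show ?thesis .
      qed
    qed
    ultimately have "z \<in> seg p (e t)" by blast
    then have "z \<in> Line t" by (simp add: Line_def long_def)
    then show False using nz Lo_Int_Up[OF t] by blast
  qed
  moreover have "ray (e u) \<subseteq> Up t" using u by (auto simp: Up_def long_def)
  ultimately show ?thesis unfolding long_def by blast
qed

end


subsection \<open>Detaching parts of a fibre\<close>

lemma separating_neighbourhood:
  fixes Q E :: "complex set"
  assumes "compact Q" "closed (E - Q)" "Q \<subseteq> E"
  shows "\<exists>U. open U \<and> bounded U \<and> frontier U \<inter> E = {} \<and> U \<inter> E = Q"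
proof -
  have "Q \<inter> (E - Q) = {}" by blast
  then obtain U V where UV: "open U" "compact (closure U)" "open V" "Q \<subseteq> U" "E - Q \<subseteq> V" "U \<inter> V = {}"
    using separation_normal_compact[OF assms(1,2)] by metis
  have "V \<inter> closure U = {}" using UV open_Int_closure_eq_empty by blast
  moreover have "frontier U = closure U - U" using UV(1) by (simp add: frontier_def interior_open)
  ultimately have "frontier U \<inter> E = {}" using UV(4,5) by auto
  moreover have "U \<inter> E = Q" using UV assms(3) by blast
  moreover have "bounded U" using UV(2) bounded_subset closure_subset compact_imp_bounded by metis
  ultimately show ?thesis using UV(1) by blast
qed

lemma exp_half_power2: "(exp (z / 2))\<^sup>2 = exp (z :: complex)"
  using exp_double[of "z / 2"] by simp

text \<open>Two logarithms of the same function differ by multiples of 2 pi i, which form a discrete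
  set.\<close>

lemma log_difference_constant:
  fixes a b :: "complex \<Rightarrow> complex"
  assumes "connected S" "continuous_on S a" "continuous_on S b" "\<And>x. x \<in> S \<Longrightarrow> exp (a x) = exp (b x)"
    and "x \<in> S" "y \<in> S"
  shows "a x - b x = a y - b y"
proof -
  have "(\<lambda>x. a x - b x) constant_on S"
  proof (rule continuous_discrete_range_constant[OF assms(1)])
    show "continuous_on S (\<lambda>x. a x - b x)" using assms by (intro continuous_intros)
    show "\<exists>e>0. \<forall>y. y \<in> S \<and> a y - b y \<noteq> a x - b x \<longrightarrow> e \<le> norm (a y - b y - (a x - b x))" if "x \<in> S" for x
    proof (intro exI[of _ "2 * pi"] conjI allI impI)
      fix y assume y: "y \<in> S \<and> a y - b y \<noteq> a x - b x"
      define z where "z = a y - b y - (a x - b x)"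
      have "exp z = 1" using assms(4)[of y] assms(4)[of x] y that by (simp add: z_def exp_diff)
      then obtain n :: int where n: "Re z = 0" "Im z = of_int (2 * n) * pi" by (auto simp: exp_eq_1)
      have "z \<noteq> 0" using y by (simp add: z_def)
      then have "n \<noteq> 0" using n by (auto simp: complex_eq_iff)
      then have "1 \<le> \<bar>real_of_int n\<bar>" by linarith
      then have "2 * pi * 1 \<le> 2 * pi * \<bar>real_of_int n\<bar>" by (intro mult_left_mono) auto
      also have "\<dots> = \<bar>Im z\<bar>" using n by (simp add: abs_mult)
      also have "\<dots> \<le> norm z" by (rule abs_Im_le_cmod)
      finally show "2 * pi \<le> norm (a y - b y - (a x - b x))" by (simp add: z_def)
    qed simp
  qed
  then show ?thesis using assms(5,6) unfolding constant_on_def by metis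
qed

context geodesic_disc
begin

lemma long_Un:
  assumes "norm p = 1" "norm q = 1" "v \<in> seg p q"
  shows "long v p \<union> long v q = seg p q \<union> ray p \<union> ray q"
proof -
  have "seg v p \<union> seg v q = seg p q" by (rule seg_Un) (use assms in auto)
  then show ?thesis unfolding long_def by blast
qed

lemma long_Int:
  assumes n: "norm p = 1" "norm q = 1" and v: "v \<in> seg p q" and ne: "p \<noteq> q"
  shows "long v p \<inter> long v q = {v}"
proof -
  have nle: "norm p \<le> 1" "norm q \<le> 1" using n by auto
  have vn: "norm v \<le> 1" using seg_in_disc[OF nle v] .
  have I: "seg v p \<inter> seg v q = {v}" using seg_Int[OF nle v] .
  have v': "v \<in> seg q p" using v seg_sym[OF nle] by simp
  have pq: "p \<in> seg v p" "q \<in> seg v q" using seg_ends vn nle by blast+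
  have rr: "ray p \<inter> ray q = {}" using mem_ray[OF n(1)] mem_ray[OF n(2)] ne by auto
  have sr: "z = q" if "z \<in> seg v p" "z \<in> ray q" for z
    using ray_Int_disc[OF n(2) that(2)] seg_in_disc[OF vn nle(1) that(1)] by blast
  have rs: "z = p" if "z \<in> seg v q" "z \<in> ray p" for z
    using ray_Int_disc[OF n(1) that(2)] seg_in_disc[OF vn nle(2) that(1)] by blast
  have "z = v" if z: "z \<in> long v p" "z \<in> long v q" for z
  proof -
    consider "z \<in> seg v p" "z \<in> seg v q" | "z \<in> seg v p" "z \<in> ray q" | "z \<in> seg v q" "z \<in> ray p"
      using z rr unfolding long_def by blast
    then show ?thesis
    proof cases
      case 1 then show ?thesis using I by blast
    next
      case 2 then have "z \<in> seg v p \<inter> seg v q" using sr pq by blast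
      then show ?thesis using I by blast
    next
      case 3 then have "z \<in> seg v p \<inter> seg v q" using rs pq by blast
      then show ?thesis using I by blast
    qed
  qed
  moreover have "v \<in> long v p" "v \<in> long v q" using seg_ends vn nle by (auto simp: long_def)
  ultimately show ?thesis by blast
qed

lemma mem_long: "\<lbrakk>norm v \<le> 1; norm q = 1\<rbrakk> \<Longrightarrow> v \<in> long v q"
  using seg_ends[of v q] by (simp add: long_def)

end

section \<open>The sum formula for parts of a fibre\<close>

context saddle_map
begin

lemma detachesI:
  assumes "compact Q" "closed (F -` long v q - Q)" "Q \<subseteq> F -` long v q" "Q \<inter> F -` {v} = A"
    and "norm v \<le> 1" "norm q = 1"
  shows "detaches v q A"
proof -
  obtain U where U: "open U" "bounded U" "frontier U \<inter> F -` long v q = {}" "U \<inter> F -` long v q = Q"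
    using separating_neighbourhood[OF assms(1-3)] by blast
  have "F -` {v} \<subseteq> F -` long v q" using mem_long assms by auto
  then have "U \<inter> F -` {v} = A" using U(4) assms(4) by blast
  then show ?thesis using U unfolding detaches_def by blast
qed

text \<open>On the compact circle the boundary map is closed, and closed monotone surjections pull
  connected sets back to connected sets.\<close>

lemma connected_circle_preimage:
  assumes "connected C" "C \<subseteq> sphere 0 1"
  shows "connected {x. norm x = 1 \<and> f x \<in> C}"
proof -
  have con: "continuous_on (sphere 0 1) f" using cont_f continuous_on_subset sphere_cball by blast
  have "connected (sphere 0 1 \<inter> f -` C)"
  proof (rule connected_closed_monotone_preimage[OF con _ _ _ assms])
    show "f ` sphere 0 1 = sphere 0 1" using f_circle f_onto by force
    show "closedin (top_of_set (sphere 0 1)) (f ` D)" if D: "closedin (top_of_set (sphere 0 1)) D" for D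
    proof -
      have "compact D" using D by (metis closedin_compact compact_sphere)
      moreover have "D \<subseteq> sphere 0 1" using D closedin_imp_subset by blast
      ultimately have "compact (f ` D)" using con compact_continuous_image continuous_on_subset by blast
      moreover have "f ` D \<subseteq> sphere 0 1" using \<open>D \<subseteq> sphere 0 1\<close> f_circle by auto
      ultimately show ?thesis by (simp add: closed_subset compact_imp_closed)
    qed
    show "connected (sphere 0 1 \<inter> f -` {y})" if "y \<in> sphere 0 1" for y
    proof -
      have "sphere 0 1 \<inter> f -` {y} = {x. norm x = 1 \<and> f x = y}" by auto
      then show ?thesis using f_fibre that by simp
    qed
  qed
  moreover have "sphere 0 1 \<inter> f -` C = {x. norm x = 1 \<and> f x \<in> C}" by auto
  ultimately show ?thesis by simp
qed

text \<open>The radial ray from \<open>x\<close> is mapped into \<open>ray (f x)\<close>, so it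
  would have to stay in the bounded set \<open>U\<close>.\<close>

lemma circle_not_detached:
  assumes x: "norm x = 1" and U: "bounded U" "frontier U \<inter> F -` long v (f x) = {}"
  shows "x \<notin> U"
proof
  assume xU: "x \<in> U"
  define A where "A = (\<lambda>t. t *\<^sub>R x) ` {1..}"
  have "F w \<in> long v (f x)" if "w \<in> A" for w
  proof -
    obtain t where "t \<in> {1..}" and t: "w = t *\<^sub>R x" using \<open>w \<in> A\<close> unfolding A_def by blast
    then have t1: "1 \<le> t" by simp
    then have "F w = t *\<^sub>R f x" using F_scale[of x t] F_in[of x] x t by simp
    then show ?thesis using t1 by (auto simp: long_def ray_def)
  qed
  then have "A \<inter> frontier U = {}" using U(2) by auto
  moreover have "connected A" unfolding A_def
    by (intro connected_continuous_image continuous_intros) auto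
  moreover have "x \<in> A" by (auto simp: A_def image_iff intro: bexI[of _ 1])
  ultimately have "A \<subseteq> U" using xU connected_Int_frontier[of A U] by blast
  then have "bounded A" using U(1) bounded_subset by blast
  then obtain B where B: "\<And>w. w \<in> A \<Longrightarrow> norm w \<le> B" by (auto simp: bounded_iff)
  have "1 \<le> B" using B[OF \<open>x \<in> A\<close>] x by simp
  then have "norm ((B + 1) *\<^sub>R x) \<le> B" by (intro B) (auto simp: A_def)
  then show False using x \<open>1 \<le> B\<close> by simp
qed

lemma connected_compl_vimage_seg:
  assumes xy: "norm x \<le> 1" "norm y \<le> 1"
  shows "compact (F -` seg x y)" "connected (- (F -` seg x y))"
proof -
  have "F -` seg x y \<subseteq> cball 0 1" using seg_in_disc[OF xy] norm_F_le by force
  then have b: "bounded (F -` seg x y)" using bounded_cball bounded_subset by blast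
  moreover have "closed (F -` seg x y)" using closed_vimage_F compact_seg[OF xy] compact_imp_closed by blast
  ultimately show "compact (F -` seg x y)" by (simp add: compact_eq_bounded_closed)
  show "connected (- (F -` seg x y))"
  proof (rule connected_if_components_unbounded)
    show "\<not> bounded (connected_component_set (- (F -` seg x y)) z)" if "z \<in> - (F -` seg x y)" for z
      by (rule unbounded_component[OF xy, of "{}"]) (use that in auto)
  qed (use b in simp)
qed

text \<open>The values of \<open>a\<close> are multiples of 2 pi i, and halving before taking
  \<open>exp\<close> reads off their parity. The shift makes the parity even on the circle fibre
  over \<open>q\<close>, which is connected and is where the preimages of segment and exterior ray
  meet. The odd part is therefore cut off from infinity.\<close>

lemma detaches_sum_half:
  fixes a :: "complex \<Rightarrow> complex"
  assumes v: "norm v \<le> 1" and q: "norm q = 1" and a: "continuous_on (F -` seg v q) a"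
    and ea: "\<And>x. x \<in> F -` seg v q \<Longrightarrow> exp (a x) = 1"
  shows "\<exists>\<alpha>. exp \<alpha> = 1 \<and> detaches v q {x. F x = v \<and> exp ((a x - \<alpha>) / 2) = - 1}"
proof -
  let ?N = "F -` seg v q" and ?P = "{x. norm x = 1 \<and> f x = q}"
  have nle: "norm q \<le> 1" using q by simp
  have qN: "q \<in> seg v q" "v \<in> seg v q" using seg_ends v nle by auto
  have PN: "?P \<subseteq> ?N" using qN by (auto simp: F_in)
  obtain x0 where x0: "x0 \<in> ?P" using f_onto q by blast
  have con: "connected ?P" using connected_circle_preimage[of "{q}"] q by simp
  have const: "a x = a x0" if "x \<in> ?P" for x
  proof -
    have "a x - 0 = a x0 - 0"
      by (rule log_difference_constant[OF con continuous_on_subset[OF a PN] _ _ that x0, of "\<lambda>_. 0"])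
        (use ea PN in \<open>auto simp: subset_iff\<close>)
    then show ?thesis by simp
  qed
  define G where "G = (\<lambda>x. exp ((a x - a x0) / 2))"
  have G2: "G x = 1 \<or> G x = -1" if "x \<in> ?N" for x
  proof -
    have "(G x)\<^sup>2 = exp (a x - a x0)" by (simp add: G_def exp_half_power2)
    also have "\<dots> = 1" using ea that x0 PN by (simp add: exp_diff subset_iff)
    finally show ?thesis by (simp add: power2_eq_1_iff)
  qed
  have contG: "continuous_on ?N G" unfolding G_def by (intro continuous_intros a) simp
  have clN: "closed ?N" "compact ?N" using connected_compl_vimage_seg(1)[OF v nle] compact_imp_closed by auto
  define Q where "Q = ?N \<inter> G -` {-1}"
  have "closed Q" unfolding Q_def by (rule continuous_closed_preimage[OF contG clN(1)]) simp
  then have cQ: "compact Q" using clN(2) by (metis Q_def compact_Int_closed inf.absorb_iff2 inf_le1)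
  have c1: "closed (?N \<inter> G -` {1})" by (rule continuous_closed_preimage[OF contG clN(1)]) simp
  have c2: "closed ({x. 1 \<le> norm x} \<inter> F -` ray q)"
  proof -
    have "closed (F -` ray q)" using closed_vimage_F closed_Union_ray[of "{q}"] q by simp
    moreover have "closed {x::complex. 1 \<le> norm x}" by (intro closed_Collect_le continuous_intros)
    ultimately show ?thesis by blast
  qed
  have "F -` long v q - Q = (?N \<inter> G -` {1}) \<union> ({x. 1 \<le> norm x} \<inter> F -` ray q)" (is "?L = ?R")
  proof
    show "?L \<subseteq> ?R"
    proof
      fix x assume x: "x \<in> ?L"
      show "x \<in> ?R"
      proof (cases "x \<in> ?N")
        case True
        then show ?thesis using x G2 by (auto simp: Q_def)
      next
        case False
        then have r: "F x \<in> ray q" using x by (auto simp: long_def)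
        have "1 \<le> norm x"
        proof (rule ccontr)
          assume "\<not> 1 \<le> norm x"
          then have "F x = q" using ray_Int_disc[OF q r] norm_F_le[of x] by simp
          then show False using False qN by simp
        qed
        then show ?thesis using r by simp
      qed
    qed
    show "?R \<subseteq> ?L"
    proof
      fix x assume x: "x \<in> ?R"
      have "x \<notin> Q" if x: "1 \<le> norm x" "F x \<in> ray q"
      proof
        assume xQ: "x \<in> Q"
        then have "norm (F x) \<le> 1" using seg_in_disc[OF v nle] by (auto simp: Q_def)
        then have "F x = q" "norm x = 1" using ray_Int_disc[OF q x(2)] norm_F_le[of x] x by auto
        then have "x \<in> ?P" using F_in[of x] by simp
        then have "G x = 1" using const by (simp add: G_def)
        then show False using xQ by (simp add: Q_def)
      qed
      then show "x \<in> ?L" using x by (auto simp: long_def Q_def)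
    qed
  qed
  then have "closed (F -` long v q - Q)" using closed_Un[OF c1 c2] by simp
  moreover have "Q \<subseteq> F -` long v q" by (auto simp: Q_def long_def)
  moreover have "Q \<inter> F -` {v} = {x. F x = v \<and> exp ((a x - a x0) / 2) = - 1}"
    using qN by (auto simp: Q_def G_def)
  ultimately have "detaches v q {x. F x = v \<and> exp ((a x - a x0) / 2) = - 1}"
    using detachesI[OF cQ] v q by blast
  moreover have "exp (a x0) = 1" using ea x0 PN by blast
  ultimately show ?thesis by blast
qed

text \<open>The preimage of \<open>[p, q]\<close> does not separate the plane, so circle-valued maps on it have
  logarithms; this is the surjectivity of the Mayer--Vietoris map for the preimages of \<open>[v, p]\<close> and
  \<open>[v, q]\<close>.\<close>

lemma detaches_sum:
  assumes v: "norm v \<le> 1" "v \<in> seg p q" and pq: "norm p = 1" "norm q = 1"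
    and A: "A \<subseteq> F -` {v}" "closed A" "closed (F -` {v} - A)"
  obtains A1 A2 where "detaches v p A1" "detaches v q A2"
    "A = (A1 - A2) \<union> (A2 - A1) \<or> F -` {v} - A = (A1 - A2) \<union> (A2 - A1)"
proof -
  have nle: "norm p \<le> 1" "norm q \<le> 1" using pq by auto
  let ?P = "F -` seg v p" and ?Q = "F -` seg v q" and ?K = "F -` {v}"
  have PQ: "?P \<union> ?Q = F -` seg p q" "?P \<inter> ?Q = ?K"
    using seg_Un[OF nle v(2)] seg_Int[OF nle v(2)] by auto
  have cl: "closed ?P" "closed ?Q"
    using connected_compl_vimage_seg(1)[OF v(1)] nle compact_imp_closed by auto
  obtain u :: "complex \<Rightarrow> real" where u: "continuous_on UNIV u" "\<And>x. x \<in> ?K - A \<Longrightarrow> u x = 0" "\<And>x. x \<in> A \<Longrightarrow> u x = 1"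
    using Urysohn[OF A(3) A(2), of 0 1] by (metis Diff_disjoint inf_commute)
  \<comment> \<open>This is the connecting map of Mayer-Vietoris. On the fibre \<open>u\<close> is
    the indicator of \<open>A\<close>, so both formulas give 1 there.\<close>
  define h where "h = (\<lambda>x. if F x \<in> seg v p then exp (2 * of_real pi * \<i> * of_real (u x)) else 1)"
  have u01: "u x = 0 \<or> u x = 1" if "F x = v" for x using u(2,3) that by (cases "x \<in> A") auto
  have ov: "exp (2 * of_real pi * \<i> * of_real (u x)) = 1" if "F x = v" for x
    using u01[OF that] by auto
  have "continuous_on (?P \<union> ?Q) h" unfolding h_def
  proof (rule continuous_on_cases[OF cl])
    show "continuous_on ?P (\<lambda>x. exp (2 * of_real pi * \<i> * of_real (u x)))"
      by (intro continuous_intros continuous_on_subset[OF u(1)]) auto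
    show "\<forall>x. x \<in> ?P \<and> F x \<notin> seg v p \<or> x \<in> ?Q \<and> F x \<in> seg v p
        \<longrightarrow> exp (2 * of_real pi * \<i> * of_real (u x)) = 1"
      using ov PQ(2) by blast
  qed simp
  then have "continuous_on (F -` seg p q) h" using PQ by simp
  moreover have "h \<in> (F -` seg p q) \<rightarrow> - {0}" by (auto simp: h_def)
  moreover have "Borsukian (F -` seg p q)"
    using Borsukian_separation_compact connected_compl_vimage_seg[OF nle] by blast
  ultimately obtain w where w: "continuous_on (F -` seg p q) w" "\<And>x. x \<in> F -` seg p q \<Longrightarrow> h x = exp (w x)"
    unfolding Borsukian_continuous_logarithm by blast
  have hQ: "h x = 1" if "x \<in> ?Q" for x
    using ov[of x] PQ(2) that by (auto simp: h_def)
  \<comment> \<open>\<open>a\<close> and \<open>w\<close> are logarithms of 1 over the two halves.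
    On the fibre they differ by 2 pi i on \<open>A\<close> and agree elsewhere, so their parities
    differ exactly on \<open>A\<close>.\<close>
  define a where "a = (\<lambda>x. w x - 2 * of_real pi * \<i> * of_real (u x))"
  have sub: "?P \<subseteq> F -` seg p q" "?Q \<subseteq> F -` seg p q" using PQ by blast+
  have "continuous_on ?P a" unfolding a_def
    by (intro continuous_intros continuous_on_subset[OF w(1)] continuous_on_subset[OF u(1)]) (use sub in auto)
  moreover have "exp (a x) = 1" if "x \<in> ?P" for x
    using w(2)[of x] sub that by (auto simp: a_def exp_diff h_def)
  ultimately obtain \<alpha> where \<alpha>: "exp \<alpha> = 1" "detaches v p {x. F x = v \<and> exp ((a x - \<alpha>) / 2) = - 1}"
    using detaches_sum_half[OF v(1) pq(1)] by blast
  have "continuous_on ?Q w" using w(1) sub continuous_on_subset by blast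
  moreover have "exp (w x) = 1" if "x \<in> ?Q" for x using w(2)[of x] hQ[OF that] sub that by auto
  ultimately obtain \<beta> where \<beta>: "exp \<beta> = 1" "detaches v q {x. F x = v \<and> exp ((w x - \<beta>) / 2) = - 1}"
    using detaches_sum_half[OF v(1) pq(2)] by blast
  define A1 where "A1 = {x. F x = v \<and> exp ((a x - \<alpha>) / 2) = - 1}"
  define A2 where "A2 = {x. F x = v \<and> exp ((w x - \<beta>) / 2) = - 1}"
  \<comment> \<open>The sign \<open>k\<close> compares the two normalizations; the value -1 leads to
    the complement of \<open>A\<close>.\<close>
  define k where "k = exp ((\<beta> - \<alpha>) / 2)"
  have k: "k = 1 \<or> k = -1"
  proof -
    have "k\<^sup>2 = exp (\<beta> - \<alpha>)" by (simp add: k_def exp_half_power2)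
    then have "k\<^sup>2 = 1" using \<alpha> \<beta> by (simp add: exp_diff)
    then show ?thesis by (simp add: power2_eq_1_iff)
  qed
  have G: "exp ((w x - \<beta>) / 2) = 1 \<or> exp ((w x - \<beta>) / 2) = -1" if "F x = v" for x
  proof -
    have "x \<in> ?Q" using that PQ(2) by blast
    then have "exp (w x) = 1" using w(2)[of x] hQ sub by auto
    then have "(exp ((w x - \<beta>) / 2))\<^sup>2 = 1" using \<beta> by (simp add: exp_half_power2 exp_diff)
    then show ?thesis by (simp add: power2_eq_1_iff)
  qed
  have rel: "exp ((a x - \<alpha>) / 2) = exp ((w x - \<beta>) / 2) * k * exp (- (of_real pi * \<i> * of_real (u x)))" for x
    unfolding k_def exp_add[symmetric] by (rule arg_cong[where f = exp]) (simp add: a_def field_simps)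
  have inA: "exp ((a x - \<alpha>) / 2) = - (exp ((w x - \<beta>) / 2) * k)" if "x \<in> A" for x
    unfolding rel using u(3)[OF that] by (simp add: exp_minus)
  have notA: "exp ((a x - \<alpha>) / 2) = exp ((w x - \<beta>) / 2) * k" if "x \<in> ?K - A" for x
    unfolding rel using u(2)[OF that] by simp
  have "A = (A1 - A2) \<union> (A2 - A1) \<or> ?K - A = (A1 - A2) \<union> (A2 - A1)"
    using k
  proof
    assume k: "k = 1"
    have "x \<in> A \<longleftrightarrow> x \<in> (A1 - A2) \<union> (A2 - A1)" if "F x = v" for x
      using inA[of x] notA[of x] G[OF that] that k by (cases "x \<in> A") (auto simp: A1_def A2_def)
    moreover have "F x = v" if "x \<in> A \<or> x \<in> (A1 - A2) \<union> (A2 - A1)" for x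
      using that A(1) by (auto simp: A1_def A2_def)
    ultimately show ?thesis by blast
  next
    assume k: "k = -1"
    have "x \<in> ?K - A \<longleftrightarrow> x \<in> (A1 - A2) \<union> (A2 - A1)" if "F x = v" for x
      using inA[of x] notA[of x] G[OF that] that k by (cases "x \<in> A") (auto simp: A1_def A2_def)
    moreover have "F x = v" if "x \<in> ?K - A \<or> x \<in> (A1 - A2) \<union> (A2 - A1)" for x
      using that A(1) by (auto simp: A1_def A2_def)
    ultimately show ?thesis by blast
  qed
  then show thesis using that \<alpha>(2) \<beta>(2) unfolding A1_def A2_def by blast
qed

end

section \<open>Parts detached along both ends of a geodesic\<close>

context sweep
begin

lemma Line_eq:
  assumes "t \<in> {0..1}" "v \<in> seg p (e t)"
  shows "Line t = long v p \<union> long v (e t)"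
  unfolding long_Un[OF norm_p norm_e[OF assms(1)] assms(2)] Line_def long_def[of p "e t"] by blast

text \<open>The preimages of the two halves of the line meet only in the fibre, where both given
  neighbourhoods cut out \<open>A\<close>. The parts cut off from the halves therefore glue to a
  compact part of the preimage of the line that has a closed complement in it.\<close>

lemma line_neighbourhood:
  assumes t: "t \<in> {0..1}" and v: "norm v \<le> 1" "v \<noteq> p" "v \<in> seg p (e t)"
    and det: "detaches v p A" "detaches v (e t) A"
  shows "\<exists>U. open U \<and> bounded U \<and> frontier U \<inter> F -` Line t = {} \<and> U \<inter> F -` {v} = A"
proof -
  obtain U where U: "open U" "bounded U" "frontier U \<inter> F -` long v p = {}" "U \<inter> F -` {v} = A"
    using det by (auto simp: detaches_def)
  obtain V where V: "open V" "bounded V" "frontier V \<inter> F -` long v (e t) = {}" "V \<inter> F -` {v} = A"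
    using det by (auto simp: detaches_def)
  let ?P = "F -` long v p" and ?Q = "F -` long v (e t)" and ?K = "F -` {v}"
  have ne: "p \<noteq> e t" using v seg_refl[of p] norm_p by auto
  have PQ: "?P \<inter> ?Q = ?K" using long_Int[OF norm_p norm_e[OF t] v(3) ne] by auto
  have E: "F -` Line t = ?P \<union> ?Q" using Line_eq[OF t v(3)] by auto
  have cl: "closed ?P" "closed ?Q" using closed_vimage_F closed_long norm_p norm_e[OF t] v by auto
  define S where "S = (?P \<inter> U) \<union> (?Q \<inter> V)"
  have "?P \<inter> U = ?P \<inter> closure U" "?Q \<inter> V = ?Q \<inter> closure V"
    using U(3) V(3) closure_Un_frontier[of U] closure_Un_frontier[of V] by auto
  moreover have "closed (?P \<inter> closure U)" "closed (?Q \<inter> closure V)" using cl by (simp_all add: closed_Int)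
  ultimately have "closed S" by (simp add: S_def closed_Un)
  moreover have "bounded S" using U V by (auto simp: S_def intro: bounded_subset)
  ultimately have "compact S" by (simp add: compact_eq_bounded_closed)
  moreover have UV: "x \<in> U \<longleftrightarrow> x \<in> V" if "x \<in> ?P" "x \<in> ?Q" for x using PQ U(4) V(4) that by blast
  then have "F -` Line t - S = (?P - U) \<union> (?Q - V)" unfolding S_def E by blast
  then have "closed (F -` Line t - S)" using cl U(1) V(1) by (auto intro: closed_Un closed_Diff)
  moreover have "S \<subseteq> F -` Line t" using E by (auto simp: S_def)
  ultimately obtain W where W: "open W" "bounded W" "frontier W \<inter> F -` Line t = {}" "W \<inter> F -` Line t = S"
    using separating_neighbourhood[of S "F -` Line t"] by metis
  have KE: "?K \<subseteq> F -` Line t" using E PQ by blast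
  then have "W \<inter> ?K = S \<inter> ?K" using W(4) by blast
  also have "\<dots> = U \<inter> ?K" using UV unfolding S_def PQ[symmetric] by blast
  also have "\<dots> = A" by (rule U(4))
  finally show ?thesis using W by blast
qed

text \<open>Otherwise the preimage of the line splits into closed sets \<open>S\<close> and
  \<open>T\<close> with circle points over \<open>e t\<close> in \<open>S\<close> and over
  \<open>p\<close> in \<open>T\<close>. Turning by plus or minus pi between them, with opposite
  signs on the two sides of the line, gives a nowhere zero function on the plane that winds around
  the circle.\<close>

lemma not_detaches_complement:
  assumes t: "t \<in> {0..1}" and v: "norm v \<le> 1" "v \<noteq> p" "v \<in> seg p (e t)"
  shows "\<not> (detaches v p A \<and> detaches v (e t) (F -` {v} - A))"
proof
  assume det: "detaches v p A \<and> detaches v (e t) (F -` {v} - A)"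
  then obtain U where U: "open U" "bounded U" "frontier U \<inter> F -` long v p = {}" "U \<inter> F -` {v} = A"
    by (auto simp: detaches_def)
  obtain V where V: "open V" "bounded V" "frontier V \<inter> F -` long v (e t) = {}" "V \<inter> F -` {v} = F -` {v} - A"
    using det by (auto simp: detaches_def)
  let ?P = "F -` long v p" and ?Q = "F -` long v (e t)" and ?K = "F -` {v}"
  have ne: "p \<noteq> e t" using v seg_refl[of p] norm_p by auto
  have PQ: "?P \<inter> ?Q = ?K" using long_Int[OF norm_p norm_e[OF t] v(3) ne] by auto
  have E: "F -` Line t = ?P \<union> ?Q" using Line_eq[OF t v(3)] by auto
  have cl: "closed ?P" "closed ?Q" using closed_vimage_F closed_long norm_p norm_e[OF t] v by auto
  define S where "S = (?P \<inter> U) \<union> (?Q - V)"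
  define T where "T = (?P - U) \<union> (?Q \<inter> V)"
  have "?P \<inter> U = ?P \<inter> closure U" "?Q \<inter> V = ?Q \<inter> closure V"
    using U(3) V(3) closure_Un_frontier[of U] closure_Un_frontier[of V] by auto
  moreover have "closed (?P \<inter> closure U)" "closed (?Q \<inter> closure V)" using cl by (simp_all add: closed_Int)
  ultimately have "closed S" "closed T" using cl U(1) V(1) by (simp_all add: S_def T_def closed_Un closed_Diff)
  moreover have "S \<inter> T = {}"
  proof -
    have "x \<in> U \<longleftrightarrow> x \<notin> V" if "x \<in> ?P" "x \<in> ?Q" for x using PQ U(4) V(4) that by blast
    then show ?thesis unfolding S_def T_def by blast
  qed
  ultimately obtain r :: "complex \<Rightarrow> real" where r: "continuous_on UNIV r"
    "\<And>x. x \<in> S \<Longrightarrow> r x = 0" "\<And>x. x \<in> T \<Longrightarrow> r x = 1"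
    using Urysohn[of S T 0 1] by metis
  have r01: "r x = 0 \<or> r x = 1" if "F x \<in> Line t" for x
  proof -
    have "x \<in> S \<union> T" using that E unfolding S_def T_def by blast
    then show ?thesis using r by blast
  qed
  \<comment> \<open>On the line \<open>r\<close> is 0 or 1, so the two conjugate values agree
    there.\<close>
  define h where "h = (\<lambda>x. if F x \<in> Up t then exp (\<i> * of_real (pi * r x)) else exp (- (\<i> * of_real (pi * r x))))"
  have agree: "exp (\<i> * of_real (pi * r x)) = exp (- (\<i> * of_real (pi * r x)))" if "F x \<in> Line t" for x
    using r01[OF that] by (auto simp: exp_minus)
  have LU: "F x \<in> Line t" if "F x \<in> Lo t" "F x \<in> Up t" for x using that Lo_Int_Up[OF t] by blast
  have "continuous_on (F -` Up t \<union> F -` Lo t) h" unfolding h_def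
    by (rule continuous_on_cases)
      (use t LU agree in \<open>auto intro!: closed_vimage_F closed_Up closed_Lo continuous_intros continuous_on_subset[OF r(1)]\<close>)
  moreover have "F -` Up t \<union> F -` Lo t = UNIV" using Lo_Un_Up by blast
  ultimately have "continuous_on UNIV h" by simp
  moreover have "h x \<noteq> 0" for x by (simp add: h_def)
  ultimately obtain g where g: "continuous_on UNIV g" "\<And>x. h x = exp (g x)"
    using continuous_logarithm_on_contractible[of UNIV h] by (metis UNIV_I contractible_UNIV)
  have et: "norm (e t) = 1" using norm_e t .
  obtain x y where x: "norm x = 1" "f x = p" and y: "norm y = 1" "f y = e t"
    using f_onto[OF norm_p] f_onto[OF et] by blast
  have rx: "r x = 1"
  proof -
    have "x \<notin> U" by (rule circle_not_detached[OF x(1) U(2)]) (use U(3) x(2) in simp)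
    moreover have "x \<in> ?P" using x F_in[of x] mem_ray_self by (simp add: long_def)
    ultimately show ?thesis using r(3) by (simp add: T_def)
  qed
  have ry: "r y = 0"
  proof -
    have "y \<notin> V" by (rule circle_not_detached[OF y(1) V(2)]) (use V(3) y(2) in simp)
    moreover have "y \<in> ?Q" using y F_in[of y] mem_ray_self by (simp add: long_def)
    ultimately show ?thesis using r(2) by (simp add: S_def)
  qed
  have arc: "connected {z. norm z = 1 \<and> f z \<in> e ` T}" if T: "connected T" "T \<subseteq> {0..1}" for T
  proof (rule connected_circle_preimage)
    show "connected (e ` T)" using cont_e T connected_continuous_image continuous_on_subset by blast
    show "e ` T \<subseteq> sphere 0 1" using norm_e T by auto
  qed
  let ?I = "{z. norm z = 1 \<and> f z \<in> e ` {t..1}}" and ?J = "{z. norm z = 1 \<and> f z \<in> e ` {0..t}}"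
  have ends: "x \<in> ?I" "y \<in> ?I" "x \<in> ?J" "y \<in> ?J"
    using x y t e_0 e_1 by (auto simp: image_iff intro: bexI[of _ 0] bexI[of _ 1] bexI[of _ t])
  have hI: "exp (g z) = exp (\<i> * of_real (pi * r z))" if "z \<in> ?I" for z
  proof -
    obtain s where s: "s \<in> {t..1}" "F z = e s" using \<open>z \<in> ?I\<close> F_in[of z] by auto
    then have "F z \<in> long p (e s)" using mem_ray_self by (simp add: long_def)
    then have "F z \<in> Up t" using s unfolding Up_def by blast
    then show ?thesis using g(2)[of z] by (simp add: h_def)
  qed
  have hJ: "exp (g z) = exp (- (\<i> * of_real (pi * r z)))" if "z \<in> ?J" for z
  proof -
    obtain s where s: "s \<in> {0..t}" "F z = e s" using \<open>z \<in> ?J\<close> F_in[of z] by auto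
    then have "F z \<in> long p (e s)" using mem_ray_self by (simp add: long_def)
    then have "F z \<in> Lo t" using s unfolding Lo_def by blast
    then show ?thesis unfolding g(2)[symmetric] h_def using agree[OF LU[of z]] by (cases "F z \<in> Up t") simp_all
  qed
  have cg: "continuous_on X g" "continuous_on X (\<lambda>z. \<i> * of_real (pi * r z))"
    "continuous_on X (\<lambda>z. - (\<i> * of_real (pi * r z)))" for X
    by (intro continuous_intros continuous_on_subset[OF g(1)] continuous_on_subset[OF r(1)]; simp)+
  \<comment> \<open>From \<open>y\<close> to \<open>x\<close>, the logarithm \<open>g\<close>
    increases by pi i along the upper arc and by minus pi i along the lower one.\<close>
  have "g x - \<i> * of_real (pi * r x) = g y - \<i> * of_real (pi * r y)"
    by (rule log_difference_constant[OF arc cg(1,2) hI ends(1,2)]) (use t in auto)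
  moreover have "g x - - (\<i> * of_real (pi * r x)) = g y - - (\<i> * of_real (pi * r y))"
    by (rule log_difference_constant[OF arc cg(1,3) hJ ends(3,4)]) (use t in auto)
  ultimately show False using rx ry by (simp add: algebra_simps)
qed

text \<open>At the extremal position each component of the neighbourhood that meets \<open>A\<close>
  is mapped into \<open>Lo t\<close>. The frontier of their union then maps off \<open>Up t\<close>,
  and \<open>Up t\<close> contains \<open>long v (e u)\<close>.\<close>

lemma detaches_one_sided:
  assumes t: "t \<in> {0..1}" and v: "norm v \<le> 1" "v \<noteq> p" "v \<in> seg p (e t)"
    and extremal: "\<And>u. \<lbrakk>t < u; u \<le> 1\<rbrakk> \<Longrightarrow> v \<notin> seg p (e u)"
    and det: "detaches v p A" "detaches v (e t) A" and u: "t \<le> u" "u \<le> 1"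
  shows "detaches v (e u) A"
proof -
  obtain U where U: "open U" "bounded U" "frontier U \<inter> F -` Line t = {}" "U \<inter> F -` {v} = A"
    using line_neighbourhood[OF t v det] by blast
  define W where "W = (\<Union>x\<in>A. connected_component_set U x)"
  have opc: "open (connected_component_set U x)" for x using U(1) by (rule open_connected_component)
  then have opW: "open W" by (auto simp: W_def)
  have WU: "W \<subseteq> U" unfolding W_def using connected_component_subset by blast
  \<comment> \<open>A point of \<open>U\<close> in the closure of a union of components of
    \<open>U\<close> has its own component in that union, however many components there are.\<close>
  have fr: "frontier X \<subseteq> frontier U"
    if X: "open X" "X \<subseteq> U" "\<And>x y. x \<in> X \<Longrightarrow> connected_component U x y \<Longrightarrow> y \<in> X" for X
  proof
    fix y assume y: "y \<in> frontier X"
    then have yc: "y \<in> closure X" "y \<notin> X" using X(1) by (auto simp: frontier_def interior_open)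
    have "y \<notin> U"
    proof
      assume "y \<in> U"
      then have "y \<in> connected_component_set U y" by simp
      then have "connected_component_set U y \<inter> X \<noteq> {}"
        using yc(1) opc[of y] open_Int_closure_eq_empty by blast
      then obtain z where "z \<in> X" "connected_component U y z" by blast
      then show False using X(3) yc(2) connected_component_sym by blast
    qed
    moreover have "y \<in> closure U" using yc(1) closure_mono[OF X(2)] by blast
    ultimately show "y \<in> frontier U" using U(1) by (simp add: frontier_def interior_open)
  qed
  have lo: "F ` connected_component_set U x \<subseteq> Lo t" if x: "x \<in> A" for x
  proof -
    let ?C = "connected_component_set U x"
    have CU: "?C \<subseteq> U" by (rule connected_component_subset)
    have xC: "x \<in> ?C" using x U(4) by auto
    have "frontier ?C \<subseteq> frontier U"
      by (rule fr[OF opc CU]) (use connected_component_trans in blast)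
    then have fC: "frontier ?C \<inter> F -` Line t = {}" using U(3) by blast
    have bC: "bounded ?C" using U(2) CU bounded_subset by blast
    have "\<not> F ` ?C \<subseteq> Up t"
      by (rule not_above_extremal[OF t v extremal bC fC xC]) (use x U(4) in auto)
    then show ?thesis using two_sides[OF t opc bC connected_connected_component fC] by blast
  qed
  then have FW: "F ` W \<subseteq> Lo t" unfolding W_def by blast
  have "frontier W \<subseteq> frontier U"
    by (rule fr[OF opW WU]) (unfold W_def, use connected_component_trans in blast)
  then have fW: "F ` frontier W \<inter> Line t = {}" using U(3) by auto
  have "F ` closure W \<subseteq> Lo t"
    by (rule image_closure_subset[OF continuous_on_F closed_Lo FW]) (use t in auto)
  moreover have "frontier W \<subseteq> closure W" by (simp add: frontier_def)
  ultimately have "F ` frontier W \<inter> Up t = {}" using fW Lo_Int_Up[OF t] by blast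
  then have "frontier W \<inter> F -` long v (e u) = {}" using long_Up[OF t v(3) u] by blast
  moreover have "W \<inter> F -` {v} = A"
  proof
    show "W \<inter> F -` {v} \<subseteq> A" using WU U(4) by blast
    show "A \<subseteq> W \<inter> F -` {v}" using U(4) unfolding W_def by (auto intro!: bexI connected_component_refl)
  qed
  moreover have "bounded W" using U(2) WU bounded_subset by blast
  ultimately show ?thesis using opW unfolding detaches_def by blast
qed

end


lemma dist_circ: "dist (circ p s) p = norm p * sqrt (2 - 2 * cos (2 * pi * s))"
proof -
  have "(norm (cis x - 1))\<^sup>2 = 2 - 2 * cos x" for x
  proof -
    have "(norm (cis x - 1))\<^sup>2 = (cos x - 1)\<^sup>2 + (sin x)\<^sup>2" by (simp add: cmod_power2)
    also have "\<dots> = ((sin x)\<^sup>2 + (cos x)\<^sup>2) + 1 - 2 * cos x" by (simp add: power2_eq_square algebra_simps)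
    finally show ?thesis by simp
  qed
  then have "norm (cis (2 * pi * s) - 1) = sqrt (2 - 2 * cos (2 * pi * s))"
    by (metis norm_ge_zero real_sqrt_unique)
  moreover have "circ p s - p = p * (cis (2 * pi * s) - 1)" by (simp add: circ_def algebra_simps)
  ultimately show ?thesis by (simp add: dist_norm norm_mult)
qed

section \<open>Extremal positions and the side of the line\<close>

context sweep
begin

lemma compact_opposite_params:
  assumes "norm v \<le> 1"
  shows "compact {t \<in> {0..1}. v \<in> seg p (e t)}"
proof -
  have "compact {q \<in> sphere 0 1. seg p q \<inter> {v} \<noteq> {}}"
    by (rule compact_seg_meets) (use norm_p in auto)
  then have "closed ({0..1} \<inter> e -` {q \<in> sphere 0 1. seg p q \<inter> {v} \<noteq> {}})"
    using continuous_closed_preimage[OF cont_e] compact_imp_closed by blast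
  moreover have "{0..1} \<inter> e -` {q \<in> sphere 0 1. seg p q \<inter> {v} \<noteq> {}} = {t \<in> {0..1}. v \<in> seg p (e t)}"
    using norm_e by auto
  ultimately have "closed {t \<in> {0..1}. v \<in> seg p (e t)}" by simp
  moreover have "bounded {t \<in> {0..1::real}. v \<in> seg p (e t)}"
    by (rule bounded_subset[of "{0..1}"]) auto
  ultimately show ?thesis by (simp add: compact_eq_bounded_closed)
qed

lemma opposite_params_nonempty:
  assumes "norm v \<le> 1"
  shows "{t \<in> {0..1}. v \<in> seg p (e t)} \<noteq> {}"
proof -
  obtain q where q: "norm q = 1" "v \<in> seg p q" using exists_seg_through[OF norm_p assms] by blast
  obtain t where "t \<in> {0..1}" "q = e t" using e_onto[OF q(1)] by blast
  then have "t \<in> {t \<in> {0..1}. v \<in> seg p (e t)}" using q(2) by simp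
  then show ?thesis by (metis empty_iff)
qed

lemma obtain_extremal:
  assumes "norm v \<le> 1"
  obtains t where "t \<in> {0..1}" "v \<in> seg p (e t)" "\<And>u. \<lbrakk>t < u; u \<le> 1\<rbrakk> \<Longrightarrow> v \<notin> seg p (e u)"
proof -
  define T where "T = {t \<in> {0..1}. v \<in> seg p (e t)}"
  have "compact T" unfolding T_def by (rule compact_opposite_params[OF assms])
  moreover have "T \<noteq> {}" unfolding T_def by (rule opposite_params_nonempty[OF assms])
  ultimately obtain t where t: "t \<in> T" "\<forall>u\<in>T. u \<le> t" using compact_attains_sup by blast
  show thesis
  proof (rule that[of t])
    show "t \<in> {0..1}" "v \<in> seg p (e t)" using t(1) by (simp_all add: T_def)
    show "v \<notin> seg p (e u)" if "t < u" "u \<le> 1" for u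
    proof
      assume "v \<in> seg p (e u)"
      then have "u \<in> T" using t(1) that by (simp add: T_def)
      then show False using t(2) that(1) by fastforce
    qed
  qed
qed

definition above :: "complex \<Rightarrow> real \<Rightarrow> bool" where
  "above x t \<longleftrightarrow> (\<exists>U. open U \<and> bounded U \<and> connected U \<and> x \<in> U \<and>
     frontier U \<inter> F -` Line t = {} \<and> F ` U \<subseteq> Up t)"

definition below :: "complex \<Rightarrow> real \<Rightarrow> bool" where
  "below x t \<longleftrightarrow> (\<exists>U. open U \<and> bounded U \<and> connected U \<and> x \<in> U \<and>
     frontier U \<inter> F -` Line t = {} \<and> F ` U \<subseteq> Lo t)"

lemma below_reverse: "below x t \<longleftrightarrow> sweep.above c f p (\<lambda>t. e (1 - t)) x (1 - t)"
  unfolding below_def sweep.above_def[OF reverse] reverse_sides by simp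

lemma above_or_below:
  assumes t: "t \<in> {0..1}" and v: "norm v \<le> 1" "v \<noteq> p" "v \<in> seg p (e t)"
    and det: "detaches v p A" "detaches v (e t) A" and x: "x \<in> A"
  shows "above x t \<or> below x t"
proof -
  obtain U where U: "open U" "bounded U" "frontier U \<inter> F -` Line t = {}" "U \<inter> F -` {v} = A"
    using line_neighbourhood[OF t v det] by blast
  let ?C = "connected_component_set U x"
  have opC: "open ?C" using U(1) by (rule open_connected_component)
  have bC: "bounded ?C" using U(2) connected_component_subset bounded_subset by blast
  have fC: "frontier ?C \<inter> F -` Line t = {}"
    using frontier_of_connected_component_subset[of U x] U(3) by blast
  have "x \<in> ?C" using x U(4) by auto
  then show ?thesis
    using two_sides[OF t opC bC connected_connected_component fC] opC bC fC connected_connected_component[of U x]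
    unfolding above_def below_def by blast
qed

text \<open>The intersection of the two neighbourhoods is mapped into the line, and so is its
  frontier by closedness. As the frontier also avoids the preimage of the line, it is empty, which
  is impossible for a bounded nonempty set.\<close>

lemma not_above_and_below:
  assumes t: "t \<in> {0..1}"
  shows "\<not> (above x t \<and> below x t)"
proof
  assume "above x t \<and> below x t"
  then obtain U V where U: "open U" "bounded U" "x \<in> U" "frontier U \<inter> F -` Line t = {}" "F ` U \<subseteq> Up t"
    and V: "open V" "bounded V" "x \<in> V" "frontier V \<inter> F -` Line t = {}" "F ` V \<subseteq> Lo t"
    unfolding above_def below_def by blast
  have "F ` (U \<inter> V) \<subseteq> Line t" using U(5) V(5) Lo_Int_Up[OF t] by blast
  then have "F ` closure (U \<inter> V) \<subseteq> Line t"
    by (rule image_closure_subset[OF continuous_on_F closed_Line[OF t]])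
  then have "frontier (U \<inter> V) \<subseteq> F -` Line t" unfolding frontier_def by blast
  moreover have "frontier (U \<inter> V) \<subseteq> frontier U \<union> frontier V" by (rule frontier_Int_subset)
  ultimately have "frontier (U \<inter> V) = {}" using U(4) V(4) by blast
  then show False using nonempty_frontier[of "U \<inter> V" x] U V bounded_Int by blast
qed

text \<open>The same neighbourhood serves: for \<open>u\<close> near \<open>t\<close> its frontier
  still maps off \<open>Lo u\<close>, so the neighbourhood cannot change to the lower side.\<close>

lemma above_nearby:
  assumes t: "t \<in> {0..1}" and x: "above x t"
  shows "\<exists>\<epsilon>>0. \<forall>u\<in>{0..1}. dist u t < \<epsilon> \<longrightarrow> above x u"
proof -
  obtain U where U: "open U" "bounded U" "connected U" "x \<in> U" "frontier U \<inter> F -` Line t = {}" "F ` U \<subseteq> Up t"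
    using x unfolding above_def by blast
  have fcl: "frontier U \<subseteq> closure U" by (simp add: frontier_def)
  have "F ` closure U \<subseteq> Up t"
    by (rule image_closure_subset[OF continuous_on_F closed_Up U(6)]) (use t in auto)
  moreover have "F ` frontier U \<inter> Line t = {}" using U(5) by auto
  ultimately have "F ` frontier U \<inter> Lo t = {}" using fcl Lo_Int_Up[OF t] by blast
  then obtain \<epsilon> where \<epsilon>: "\<epsilon> > 0" "\<And>u. \<lbrakk>u \<le> 1; u < t + \<epsilon>\<rbrakk> \<Longrightarrow> F ` frontier U \<inter> Lo u = {}"
    using Lo_nearby[OF compact_F_frontier[OF U(2)]] t by (metis atLeastAtMost_iff)
  have "above x u" if u: "u \<in> {0..1}" "dist u t < \<epsilon>" for u
  proof -
    have L: "F ` frontier U \<inter> Lo u = {}" using \<epsilon>(2)[of u] u by (auto simp: dist_real_def)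
    then have fr: "frontier U \<inter> F -` Line u = {}" using Lo_Int_Up[OF u(1)] by blast
    have "\<not> F ` U \<subseteq> Lo u"
    proof
      assume lo: "F ` U \<subseteq> Lo u"
      have "F ` closure U \<subseteq> Lo u"
        by (rule image_closure_subset[OF continuous_on_F closed_Lo lo]) (use u in auto)
      then have "frontier U = {}" using L fcl by blast
      then show False using nonempty_frontier[OF U(2,4)] by simp
    qed
    then have "F ` U \<subseteq> Up u" using two_sides[OF u(1) U(1-3) fr] by blast
    then show ?thesis using U fr unfolding above_def by blast
  qed
  then show ?thesis using \<epsilon>(1) by blast
qed

lemma not_above_last:
  assumes v: "norm v \<le> 1" "v \<noteq> p" "F x = v"
  obtains t where "t \<in> {0..1}" "v \<in> seg p (e t)" "\<not> above x t"
proof -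
  obtain t where t: "t \<in> {0..1}" "v \<in> seg p (e t)" "\<And>u. \<lbrakk>t < u; u \<le> 1\<rbrakk> \<Longrightarrow> v \<notin> seg p (e u)"
    using obtain_extremal[OF v(1)] by blast
  have "\<not> above x t"
    using not_above_extremal[OF t(1) v(1,2) t(2,3) _ _ _ v(3)] unfolding above_def by blast
  then show thesis using that t by blast
qed

text \<open>As \<open>q\<close> runs through the points with \<open>v \<in> [p, q]\<close>, the side of \<open>[p, q]\<close> from which the
  image approaches \<open>v\<close> near \<open>x\<close> cannot change; but at either extreme position of \<open>q\<close> one of the
  sides is excluded.\<close>

lemma not_detached_everywhere:
  assumes v: "norm v \<le> 1" "v \<noteq> p" and det: "\<And>q. norm q = 1 \<Longrightarrow> detaches v q A"
  shows "A = {}"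
proof (rule ccontr)
  assume "A \<noteq> {}"
  then obtain x where x: "x \<in> A" by blast
  have Fx: "F x = v" using det[OF norm_p] x unfolding detaches_def by blast
  define T where "T = {t \<in> {0..1}. v \<in> seg p (e t)}"
  have T01: "T \<subseteq> {0..1}" by (auto simp: T_def)
  have "is_interval T"
    unfolding is_interval_1 T_def using between[where w = v] by force
  then have con: "connected T" by (simp add: is_interval_connected)
  have AB: "above x t \<or> below x t" if "t \<in> T" for t
    using above_or_below[OF _ v _ det[OF norm_p] det[OF norm_e] x] that by (auto simp: T_def)
  have nAB: "\<not> (above x t \<and> below x t)" if "t \<in> T" for t
    using not_above_and_below that T01 by blast
  have opA: "openin (top_of_set T) {t \<in> T. above x t}"
    unfolding openin_euclidean_subtopology_iff
  proof (intro conjI ballI)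
    fix t assume t: "t \<in> {t \<in> T. above x t}"
    then obtain \<epsilon> where "\<epsilon> > 0" "\<forall>u\<in>{0..1}. dist u t < \<epsilon> \<longrightarrow> above x u"
      using above_nearby[of t x] T01 by blast
    then show "\<exists>\<epsilon>>0. \<forall>u\<in>T. dist u t < \<epsilon> \<longrightarrow> u \<in> {t \<in> T. above x t}"
      using T01 by blast
  qed blast
  have opB: "openin (top_of_set T) {t \<in> T. below x t}"
    unfolding openin_euclidean_subtopology_iff
  proof (intro conjI ballI)
    fix t assume t: "t \<in> {t \<in> T. below x t}"
    then have "1 - t \<in> {0..1}" using T01 by auto
    then obtain \<epsilon> where \<epsilon>: "\<epsilon> > 0"
      "\<And>u. \<lbrakk>u \<in> {0..1}; dist u (1 - t) < \<epsilon>\<rbrakk> \<Longrightarrow> sweep.above c f p (\<lambda>t. e (1 - t)) x u"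
      using sweep.above_nearby[OF reverse, of "1 - t" x] t below_reverse by blast
    have "below x u" if "u \<in> T" "dist u t < \<epsilon>" for u
      unfolding below_reverse by (rule \<epsilon>(2)) (use that T01 in \<open>auto simp: dist_real_def\<close>)
    then show "\<exists>\<epsilon>>0. \<forall>u\<in>T. dist u t < \<epsilon> \<longrightarrow> u \<in> {t \<in> T. below x t}"
      using \<epsilon>(1) by blast
  qed blast
  obtain t where t: "t \<in> T" "\<not> above x t"
    using not_above_last[OF v Fx] by (auto simp: T_def)
  \<comment> \<open>The last position of the reversed sweep is the first one of the given sweep, and
    there the side \<open>below\<close> is excluded.\<close>
  obtain s where s: "s \<in> {0..1}" "v \<in> seg p (e (1 - s))" "\<not> sweep.above c f p (\<lambda>t. e (1 - t)) x s"
    using sweep.not_above_last[OF reverse v Fx] by blast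
  then have s': "1 - s \<in> T" "\<not> below x (1 - s)" by (auto simp: T_def below_reverse)
  have "{t \<in> T. below x t} \<noteq> {}" using t AB by blast
  moreover have "{t \<in> T. above x t} \<noteq> {}" using s' AB by blast
  moreover have "T \<subseteq> {t \<in> T. above x t} \<union> {t \<in> T. below x t}" using AB by blast
  moreover have "{t \<in> T. above x t} \<inter> {t \<in> T. below x t} = {}" using nAB by blast
  ultimately show False using con opA opB unfolding connected_openin by blast
qed

end

section \<open>Detachedness spreads along the circle\<close>

context saddle_map
begin

lemma sweep_circ:
  assumes "norm p = 1"
  shows "sweep d c f p (circ p)"
proof (intro sweep.intro saddle_map_axioms sweep_axioms.intro)
  have p0: "p \<noteq> 0" using assms by auto
  show "\<exists>t\<in>{0..1}. q = circ p t" if "norm q = 1" for q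
    using circ_surj assms that by blast
  show "s = t \<or> {s, t} = {0, 1}" if "s \<in> {0..1}" "t \<in> {0..1}" "circ p s = circ p t" for s t
    using circ_eq_iff[OF p0] that by blast
  show "w \<in> seg p (circ p t)"
    if "0 \<le> s" "s \<le> t" "t \<le> u" "u \<le> 1" "w \<in> seg p (circ p s)" "w \<in> seg p (circ p u)" for s t u w
    using seg_circ_between[OF assms] that by blast
qed (use assms continuous_on_circ in auto)

text \<open>The orientation is chosen so that after \<open>a\<close> only the shorter arc back to
  \<open>p\<close> remains. A point farther from \<open>p\<close> than \<open>a\<close> is then met
  before \<open>a\<close>.\<close>

lemma sweep_towards:
  assumes p: "norm p = 1" and a: "norm a = 1"
  obtains e s where "sweep d c f p e" "s \<in> {0..1}" "e s = a"
    "\<And>t. \<lbrakk>s \<le> t; t \<le> 1\<rbrakk> \<Longrightarrow> dist (e t) p \<le> dist a p"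
proof -
  have p0: "p \<noteq> 0" "a / p \<noteq> 0" using p a by auto
  define \<phi> where "\<phi> = Arg (a / p)"
  have "norm (a / p) = 1" using p a by (simp add: norm_divide)
  then have "a / p = cis \<phi>" using cis_Arg_unique Arg_eq[OF p0(2)] by (simp add: cis_conv_exp \<phi>_def)
  then have a_eq: "a = p * cis \<phi>" using p0 by (simp add: field_simps)
  have \<phi>: "-pi < \<phi>" "\<phi> \<le> pi" using mpi_less_Arg Arg_le_pi by (auto simp: \<phi>_def)
  \<comment> \<open>What remains after \<open>s\<close> is the fraction of the circle between
    \<open>a\<close> and \<open>p\<close>, at most one half.\<close>
  define s where "s = 1 - \<bar>\<phi>\<bar> / (2 * pi)"
  have s: "s \<in> {0..1}" "1 / 2 \<le> s" using \<phi> by (auto simp: s_def field_simps abs_if)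
  have mono: "sqrt (2 - 2 * cos (2 * pi * (1 - t))) \<le> sqrt (2 - 2 * cos (2 * pi * (1 - s)))"
    if t: "s \<le> t" "t \<le> 1" for t
  proof -
    have "0 \<le> 2 * pi * (1 - t)" using t by simp
    moreover have "2 * pi * (1 - t) \<le> 2 * pi * (1 - s)" using t by (intro mult_left_mono) auto
    moreover have "2 * pi * (1 - s) \<le> 2 * pi * (1 / 2)" using s by (intro mult_left_mono) auto
    ultimately have "cos (2 * pi * (1 - s)) \<le> cos (2 * pi * (1 - t))"
      by (intro cos_monotone_0_pi_le) auto
    then show ?thesis by simp
  qed
  show thesis
  proof (cases "\<phi> \<le> 0")
    case True
    have "2 * pi * s = \<phi> + 2 * pi" using True by (simp add: s_def field_simps)
    then have cs: "circ p s = a" by (simp add: circ_def a_eq cis_mult[symmetric])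
    have eq: "cos (2 * pi * t) = cos (2 * pi * (1 - t))" for t
    proof -
      have "2 * pi * (1 - t) = - (2 * pi * t) + 2 * pi" by (simp add: algebra_simps)
      then show ?thesis by (metis cos_minus cos_periodic)
    qed
    have "dist (circ p t) p \<le> dist a p" if "s \<le> t" "t \<le> 1" for t
      unfolding cs[symmetric] dist_circ eq[of t] eq[of s] using mono[OF that] p by simp
    then show thesis by (rule that[OF sweep_circ[OF p] s(1) cs])
  next
    case False
    have "2 * pi * (1 - s) = \<phi>" using False by (simp add: s_def)
    then have cs: "circ p (1 - s) = a" by (simp add: circ_def a_eq)
    have "dist (circ p (1 - t)) p \<le> dist a p" if "s \<le> t" "t \<le> 1" for t
      unfolding cs[symmetric] dist_circ using mono[OF that] p by simp
    then show thesis by (rule that[OF sweep.reverse[OF sweep_circ[OF p]] s(1) cs])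
  qed
qed

lemma detached_subset: "detaches v q A \<Longrightarrow> A \<subseteq> F -` {v}"
  unfolding detaches_def by blast

lemma closed_detached:
  assumes "detaches v q A" "norm v \<le> 1" "norm q = 1"
  shows "closed A" "closed (F -` {v} - A)"
proof -
  obtain U where U: "open U" "frontier U \<inter> F -` long v q = {}" "U \<inter> F -` {v} = A"
    using assms by (auto simp: detaches_def)
  have K: "closed (F -` {v})" by (rule closed_vimage_F) simp
  have "F -` {v} \<subseteq> F -` long v q" using mem_long[OF assms(2,3)] by auto
  then have "A = closure U \<inter> F -` {v}" using U closure_Un_frontier[of U] by blast
  then show "closed A" using closed_Int[OF closed_closure K] by simp
  have "F -` {v} - A = F -` {v} - U" using U(3) by blast
  then show "closed (F -` {v} - A)" using closed_Diff[OF K U(1)] by simp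
qed

text \<open>Here \<open>q\<close> is the last point with \<open>v\<close> on \<open>[p, q]\<close>
  in a sweep towards \<open>a\<close>. Either it is reached no earlier than \<open>a\<close> and is
  close to \<open>p\<close>, or it is reached before \<open>a\<close>, and
  \<open>detaches_one_sided\<close> carries detachedness on to \<open>a\<close>.\<close>

lemma obtain_opposite:
  assumes v: "norm v \<le> 1" "v \<noteq> p" and p: "norm p = 1" and a: "norm a = 1"
  obtains q where "norm q = 1" "v \<in> seg p q" "\<And>B. \<not> (detaches v p B \<and> detaches v q (F -` {v} - B))"
    "dist q p \<le> dist a p \<or> (\<forall>B. detaches v p B \<and> detaches v q B \<longrightarrow> detaches v a B)"
proof -
  obtain e s where e: "sweep d c f p e" "s \<in> {0..1}" "e s = a"
    "\<And>t. \<lbrakk>s \<le> t; t \<le> 1\<rbrakk> \<Longrightarrow> dist (e t) p \<le> dist a p"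
    using sweep_towards[OF p a] by blast
  obtain t where t: "t \<in> {0..1}" "v \<in> seg p (e t)" "\<And>u. \<lbrakk>t < u; u \<le> 1\<rbrakk> \<Longrightarrow> v \<notin> seg p (e u)"
    using sweep.obtain_extremal[OF e(1) v(1)] by blast
  show thesis
  proof (rule that[of "e t"])
    show "norm (e t) = 1" using sweep.norm_e[OF e(1) t(1)] .
    show "v \<in> seg p (e t)" by (rule t(2))
    show "\<not> (detaches v p B \<and> detaches v (e t) (F -` {v} - B))" for B
      by (rule sweep.not_detaches_complement[OF e(1) t(1) v t(2)])
    show "dist (e t) p \<le> dist a p \<or> (\<forall>B. detaches v p B \<and> detaches v (e t) B \<longrightarrow> detaches v a B)"
    proof (cases "s \<le> t")
      case True
      then show ?thesis using e(4) t(1) by auto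
    next
      case False
      have "detaches v (e s) B" if "detaches v p B" "detaches v (e t) B" for B
        by (rule sweep.detaches_one_sided[OF e(1) t(1) v t(2,3) that]) (use False e(2) in auto)
      then show ?thesis using e(3) by blast
    qed
  qed
qed

lemma connected_punctured_circle: "connected (sphere (0::complex) 1 - {v})"
proof (cases "norm v = 1")
  case False
  then have "sphere 0 1 - {v} = sphere 0 1" by auto
  then show ?thesis by (simp add: connected_sphere)
next
  case True
  then have v0: "v \<noteq> 0" by auto
  have "sphere 0 1 - {v} = circ v ` {0<..<1}"
  proof
    show "sphere 0 1 - {v} \<subseteq> circ v ` {0<..<1}"
    proof
      fix q assume q: "q \<in> sphere 0 1 - {v}"
      then obtain t where t: "t \<in> {0..1}" "q = circ v t" using circ_surj[OF True, of q] by auto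
      have "t \<noteq> 0" "t \<noteq> 1" using t q by auto
      then show "q \<in> circ v ` {0<..<1}" using t by auto
    qed
    show "circ v ` {0<..<1} \<subseteq> sphere 0 1 - {v}"
    proof
      fix q assume "q \<in> circ v ` {0<..<1}"
      then obtain t where t: "t \<in> {0<..<1}" "q = circ v t" by auto
      then have "circ v t \<noteq> circ v 0" using circ_eq_iff[OF v0, of t 0] by (auto simp: doubleton_eq_iff)
      then show "q \<in> sphere 0 1 - {v}" using t True by simp
    qed
  qed
  then show ?thesis using connected_continuous_image[OF continuous_on_circ[of "{0<..<1}"]] by simp
qed

text \<open>Along the limit \<open>a\<close> and an opposite \<open>b\<close> the sum formula splits
  \<open>A\<close> into two parts, which by openness are also detached along \<open>p n\<close> and
  \<open>q n\<close> respectively. Subtracting the first from \<open>A\<close> at \<open>p n\<close>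
  shows that the second is detached along \<open>p n\<close> too, and so along
  \<open>a\<close>.\<close>

lemma detaches_closed:
  assumes v: "norm v \<le> 1" and a: "norm a = 1" "a \<noteq> v"
    and A: "\<And>n. norm (p n) = 1" "\<And>n. p n \<noteq> v" "\<And>n::nat. detaches v (p n) A" "p \<longlonglongrightarrow> a"
  shows "detaches v a A"
proof -
  have "\<exists>q. norm q = 1 \<and> v \<in> seg (p n) q \<and> (\<forall>B. \<not> (detaches v (p n) B \<and> detaches v q (F -` {v} - B))) \<and>
    (dist q (p n) \<le> dist a (p n) \<or> (\<forall>B. detaches v (p n) B \<and> detaches v q B \<longrightarrow> detaches v a B))" for n
    using obtain_opposite[OF v A(2)[of n, symmetric] A(1)[of n] a(1)] by metis
  then obtain q where q: "\<And>n. norm (q n) = 1" "\<And>n. v \<in> seg (p n) (q n)"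
    "\<And>n B. \<not> (detaches v (p n) B \<and> detaches v (q n) (F -` {v} - B))"
    "\<And>n. dist (q n) (p n) \<le> dist a (p n) \<or> (\<forall>B. detaches v (p n) B \<and> detaches v (q n) B \<longrightarrow> detaches v a B)"
    by metis
  have "seq_compact {(p, q). norm p = 1 \<and> norm q = 1 \<and> v \<in> seg p q}"
    using compact_opposite[OF v] by (rule compact_imp_seq_compact)
  moreover have "\<forall>n. (p n, q n) \<in> {(p, q). norm p = 1 \<and> norm q = 1 \<and> v \<in> seg p q}" using A q by simp
  ultimately obtain l r where l: "l \<in> {(p, q). norm p = 1 \<and> norm q = 1 \<and> v \<in> seg p q}"
    and r: "strict_mono (r :: nat \<Rightarrow> nat)" "((\<lambda>n. (p n, q n)) \<circ> r) \<longlonglongrightarrow> l"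
    by (rule seq_compactE)
  obtain a' b where ab: "l = (a', b)" by (cases l)
  have "(\<lambda>n. p (r n)) \<longlonglongrightarrow> a'" using tendsto_fst[OF r(2)] by (simp add: ab o_def)
  moreover have pr: "(\<lambda>n. p (r n)) \<longlonglongrightarrow> a" using LIMSEQ_subseq_LIMSEQ[OF A(4) r(1)] by (simp add: o_def)
  ultimately have "a' = a" using LIMSEQ_unique by blast
  have qr: "(\<lambda>n. q (r n)) \<longlonglongrightarrow> b" using tendsto_snd[OF r(2)] by (simp add: ab o_def)
  have b: "norm b = 1" "v \<in> seg a b" using l ab \<open>a' = a\<close> by auto
  have ba: "b \<noteq> a" using b(2) seg_refl[of a] a by auto
  note cl = closed_detached[OF A(3)[of 0] v A(1)[of 0]]
  obtain A1 A2 where A12: "detaches v a A1" "detaches v b A2"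
    "A = (A1 - A2) \<union> (A2 - A1) \<or> F -` {v} - A = (A1 - A2) \<union> (A2 - A1)"
    using detaches_sum[OF v b(2) a(1) b(1) detached_subset[OF A(3)[of 0]] cl] by blast
  obtain \<alpha> where \<alpha>: "\<alpha> > 0" "\<And>r. \<lbrakk>norm r = 1; dist r a < \<alpha>\<rbrakk> \<Longrightarrow> detaches v r A1"
    using detaches_nearby[OF A12(1) v] by blast
  obtain \<beta> where \<beta>: "\<beta> > 0" "\<And>r. \<lbrakk>norm r = 1; dist r b < \<beta>\<rbrakk> \<Longrightarrow> detaches v r A2"
    using detaches_nearby[OF A12(2) v] by blast
  have "\<forall>\<^sub>F n in sequentially. dist (p (r n)) a < \<alpha>" using pr \<alpha>(1) by (rule tendstoD)
  moreover have "\<forall>\<^sub>F n in sequentially. dist (q (r n)) b < \<beta>" using qr \<beta>(1) by (rule tendstoD)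
  \<comment> \<open>Since \<open>b\<close> differs from \<open>a\<close>, the points
    \<open>q (r n)\<close> are eventually farther from \<open>p (r n)\<close> than \<open>a\<close>
    is, which leaves the second alternative of \<open>q(4)\<close>.\<close>
  moreover have "(\<lambda>n. dist (q (r n)) (p (r n)) - dist a (p (r n))) \<longlonglongrightarrow> dist b a - dist a a"
    by (intro tendsto_intros pr qr)
  then have "\<forall>\<^sub>F n in sequentially. 0 < dist (q (r n)) (p (r n)) - dist a (p (r n))"
    using ba by (intro order_tendstoD(1)) auto
  ultimately have "\<forall>\<^sub>F n in sequentially. dist (p (r n)) a < \<alpha> \<and> dist (q (r n)) b < \<beta> \<and>
      0 < dist (q (r n)) (p (r n)) - dist a (p (r n))"
    by (intro eventually_conj)
  then obtain n where n: "dist (p (r n)) a < \<alpha>" "dist (q (r n)) b < \<beta>"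
      "0 < dist (q (r n)) (p (r n)) - dist a (p (r n))"
    using eventually_happens'[OF sequentially_bot] by blast
  let ?p = "p (r n)" and ?q = "q (r n)"
  have transfer: "\<And>B. detaches v ?p B \<Longrightarrow> detaches v ?q B \<Longrightarrow> detaches v a B"
    using q(4)[of "r n"] n(3) by auto
  have p1: "detaches v ?p A1" and q2: "detaches v ?q A2"
    using \<alpha>(2)[OF A(1) n(1)] \<beta>(2)[OF q(1) n(2)] by blast+
  have sd: "detaches v ?p ((A - A1) \<union> (A1 - A))"
    using detaches_sym_diff[OF A(3) p1 v A(1)] .
  have subs: "A \<subseteq> F -` {v}" "A1 \<subseteq> F -` {v}" "A2 \<subseteq> F -` {v}"
    using detached_subset A(3)[of 0] A12(1,2) by blast+
  show ?thesis
    using A12(3)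
  proof
    assume eq: "A = (A1 - A2) \<union> (A2 - A1)"
    then have "(A - A1) \<union> (A1 - A) = A2" by blast
    then have "detaches v a A2" using transfer sd q2 by simp
    then show ?thesis using detaches_sym_diff[OF A12(1) _ v a(1)] eq by simp
  next
    \<comment> \<open>Complementary parts would here be detached along \<open>p (r n)\<close> and
      along its opposite point.\<close>
    assume "F -` {v} - A = (A1 - A2) \<union> (A2 - A1)"
    then have "F -` {v} - ((A - A1) \<union> (A1 - A)) = A2" using subs by blast
    then show ?thesis using q(3)[of "r n"] sd q2 by metis
  qed
qed

text \<open>Being detached is open by \<open>detaches_nearby\<close> and closed by
  \<open>detaches_closed\<close>. If \<open>v\<close> lies on the circle, \<open>[v, v]\<close> is
  degenerate, so the argument runs on the circle punctured at \<open>v\<close>, which is still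
  connected.\<close>

lemma detaches_propagates:
  assumes v: "norm v \<le> 1" and q: "norm q = 1" "q \<noteq> v" "detaches v q A" and r: "norm r = 1" "r \<noteq> v"
  shows "detaches v r A"
proof -
  let ?W = "sphere 0 1 - {v}"
  have "openin (top_of_set ?W) {q \<in> ?W. detaches v q A}"
    unfolding openin_euclidean_subtopology_iff
  proof (intro conjI ballI)
    fix q assume "q \<in> {q \<in> ?W. detaches v q A}"
    then obtain \<epsilon> where "\<epsilon> > 0" "\<And>r. \<lbrakk>norm r = 1; dist r q < \<epsilon>\<rbrakk> \<Longrightarrow> detaches v r A"
      using detaches_nearby[of v q A] v by blast
    then show "\<exists>\<epsilon>>0. \<forall>r\<in>?W. dist r q < \<epsilon> \<longrightarrow> r \<in> {q \<in> ?W. detaches v q A}"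
      by (intro exI[of _ \<epsilon>]) auto
  qed blast
  moreover have "openin (top_of_set ?W) {q \<in> ?W. \<not> detaches v q A}"
    unfolding openin_euclidean_subtopology_iff
  proof (intro conjI ballI)
    fix a assume a: "a \<in> {q \<in> ?W. \<not> detaches v q A}"
    show "\<exists>\<epsilon>>0. \<forall>r\<in>?W. dist r a < \<epsilon> \<longrightarrow> r \<in> {q \<in> ?W. \<not> detaches v q A}"
    proof (rule ccontr)
      assume "\<not> ?thesis"
      then have "\<exists>r\<in>?W. dist r a < \<epsilon> \<and> detaches v r A" if "\<epsilon> > 0" for \<epsilon> using that by blast
      then have "\<exists>r. r \<in> ?W \<and> dist r a < inverse (real (Suc n)) \<and> detaches v r A" for n
        by (metis inverse_positive_iff_positive of_nat_0_less_iff zero_less_Suc)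
      then obtain p where p: "\<And>n. p n \<in> ?W" "\<And>n. dist (p n) a < inverse (real (Suc n))" "\<And>n. detaches v (p n) A"
        by metis
      have "(\<lambda>n. dist (p n) a) \<longlonglongrightarrow> 0"
        by (rule tendsto_sandwich[OF _ _ tendsto_const LIMSEQ_inverse_real_of_nat])
          (use p(2) in \<open>auto intro!: always_eventually less_imp_le\<close>)
      then have "p \<longlonglongrightarrow> a" by (rule tendsto_dist_iff[THEN iffD2])
      then have "detaches v a A" using p(1,3) a by (intro detaches_closed[of v a p A] v) auto
      then show False using a by blast
    qed
  qed blast
  moreover have "q \<in> {q \<in> ?W. detaches v q A}" using q by simp
  ultimately have "{q \<in> ?W. \<not> detaches v q A} = {}"
    using connected_punctured_circle[of v] unfolding connected_openin by blast
  moreover have "r \<in> ?W" using r by simp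
  ultimately show ?thesis by blast
qed

text \<open>The preimage of \<open>long v v\<close> consists of the fibre and an exterior part, and
  these meet only on the circle, which \<open>A\<close> avoids.\<close>

lemma detaches_self:
  assumes v: "norm v = 1" and A: "A \<subseteq> F -` {v}" "closed A" "closed (F -` {v} - A)"
    and no: "A \<inter> sphere 0 1 = {}"
  shows "detaches v v A"
proof -
  have nle: "norm v \<le> 1" using v by simp
  have "compact (F -` {v})" using connected_compl_vimage_seg(1)[OF nle nle] seg_refl[OF nle] by simp
  then have "bounded A" using A(1) bounded_subset compact_imp_bounded by blast
  then have cA: "compact A" using A(2) by (simp add: compact_eq_bounded_closed)
  have l: "long v v = insert v (ray v)" using seg_refl[OF nle] by (simp add: long_def)
  have c2: "closed ({x. 1 \<le> norm x} \<inter> F -` ray v)"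
  proof -
    have "closed (F -` ray v)" using closed_vimage_F closed_Union_ray[of "{v}"] v by simp
    moreover have "closed {x::complex. 1 \<le> norm x}" by (intro closed_Collect_le continuous_intros)
    ultimately show ?thesis by blast
  qed
  have ray: "F x = v \<and> norm x \<le> 1" if "F x \<in> ray v" "norm x \<le> 1" for x
    using ray_Int_disc[OF v that(1)] norm_F_le[of x] that by blast
  have "x \<notin> A" if "1 \<le> norm x" "F x \<in> ray v" for x
  proof
    assume x: "x \<in> A"
    then have "norm (F x) = 1" using A(1) v by auto
    then have "norm x = 1" using norm_F_out[OF that(1)] by simp
    then show False using no x by auto
  qed
  moreover have "F x = v" if "F x \<in> ray v" "\<not> 1 \<le> norm x" for x using ray[OF that(1)] that(2) by simp
  ultimately have "F -` long v v - A = (F -` {v} - A) \<union> ({x. 1 \<le> norm x} \<inter> F -` ray v)"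
    unfolding l by blast
  then have "closed (F -` long v v - A)" using closed_Un[OF A(3) c2] by simp
  moreover have "A \<subseteq> F -` long v v" using A(1) l by auto
  ultimately show ?thesis using detachesI[OF cA _ _ _ nle v] A(1) by blast
qed

lemma exists_unit_ne: "\<exists>p::complex. norm p = 1 \<and> p \<noteq> v"
proof (cases "v = 1")
  case True
  then show ?thesis by (intro exI[of _ "- 1"]) simp
next
  case False
  then show ?thesis by (intro exI[of _ 1]) simp
qed

lemma not_detached:
  assumes v: "norm v \<le> 1" and q: "norm q = 1" "q \<noteq> v" "detaches v q A"
    and self: "norm v = 1 \<Longrightarrow> detaches v v A"
  shows "A = {}"
proof -
  obtain p where p: "norm p = 1" "p \<noteq> v" using exists_unit_ne by blast
  have "detaches v r A" if "norm r = 1" for r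
    using detaches_propagates[OF v q that] self that by (cases "r = v") auto
  then show ?thesis
    using sweep.not_detached_everywhere[OF sweep_circ[OF p(1)] v p(2)[symmetric]] by blast
qed

section \<open>Nonempty and connected fibres\<close>

lemma fibre_nonempty:
  assumes v: "norm v \<le> 1"
  shows "F -` {v} \<noteq> {}"
proof
  assume K: "F -` {v} = {}"
  obtain p where p: "norm p = 1" "p \<noteq> v" using exists_unit_ne by blast
  obtain q where "\<And>B. \<not> (detaches v p B \<and> detaches v q (F -` {v} - B))"
    using obtain_opposite[OF v p(2)[symmetric] p(1) p(1)] by metis
  \<comment> \<open>If the fibre is empty, the empty part is its own complement, hence detached
    together with it along opposite points.\<close>
  moreover have "detaches v r {}" for r unfolding detaches_def by (intro exI[of _ "{}"]) simp
  ultimately show False using K by (metis empty_Diff)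
qed

lemma fibre_connected:
  assumes v: "norm v \<le> 1"
  shows "connected (F -` {v})"
proof (rule ccontr)
  let ?K = "F -` {v}"
  assume "\<not> connected ?K"
  moreover have "closed ?K" by (rule closed_vimage_F) simp
  ultimately obtain A B where AB: "closed A" "closed B" "A \<noteq> {}" "B \<noteq> {}" "A \<union> B = ?K" "A \<inter> B = {}"
    unfolding connected_closed_set[OF \<open>closed ?K\<close>] by blast
  have diff: "?K - A = B" "?K - B = A" using AB by blast+
  show False
  proof (cases "norm v = 1")
    case True
    let ?P = "{x. norm x = 1 \<and> f x = v}"
    have PK: "?P \<subseteq> ?K" using F_in by auto
    have "connected ?P" using f_fibre[OF True] .
    \<comment> \<open>By connectedness of the circle fibre one of the two pieces misses it. That
      piece is detached along \<open>v\<close> itself, and so along nearby points of the circle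
      other than \<open>v\<close>.\<close>
    then have disj: "A \<inter> ?P = {} \<or> B \<inter> ?P = {}"
      by (rule connected_closedD) (use AB PK in auto)
    have sph: "C \<inter> sphere 0 1 = {}" if "C \<subseteq> ?K" "C \<inter> ?P = {}" for C
    proof -
      have "x \<in> ?P" if "x \<in> C" "norm x = 1" for x
        using F_in[of x] \<open>C \<subseteq> ?K\<close> that by auto
      then show ?thesis using \<open>C \<inter> ?P = {}\<close> by auto
    qed
    have "\<exists>C. C \<noteq> {} \<and> C \<subseteq> ?K \<and> closed C \<and> closed (?K - C) \<and> C \<inter> sphere 0 1 = {}"
    proof (rule disjE[OF disj])
      assume "A \<inter> ?P = {}"
      then show ?thesis using AB diff sph[of A] by (intro exI[of _ A]) auto
    next
      assume "B \<inter> ?P = {}"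
      then show ?thesis using AB diff sph[of B] by (intro exI[of _ B]) auto
    qed
    then obtain C where C: "C \<noteq> {}" "C \<subseteq> ?K" "closed C" "closed (?K - C)" "C \<inter> sphere 0 1 = {}"
      by blast
    have det: "detaches v v C" by (rule detaches_self[OF True C(2-5)])
    obtain \<epsilon> where \<epsilon>: "\<epsilon> > 0" "\<And>r. \<lbrakk>norm r = 1; dist r v < \<epsilon>\<rbrakk> \<Longrightarrow> detaches v r C"
      using detaches_nearby[OF det v] by blast
    have "isCont (circ v) 0"
      using continuous_on_circ[of UNIV v] by (simp add: continuous_on_eq_continuous_at)
    then have "(circ v \<longlongrightarrow> v) (at 0)" by (simp add: isCont_def)
    then have "\<forall>\<^sub>F t in at 0. dist (circ v t) v < \<epsilon>" using \<epsilon>(1) by (rule tendstoD)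
    then have "\<forall>\<^sub>F t in at_right 0. dist (circ v t) v < \<epsilon>" by (simp add: eventually_at_split)
    moreover have "\<forall>\<^sub>F t in at_right (0::real). t \<in> {0<..<1}" by (rule eventually_at_right_real) simp
    ultimately have "\<forall>\<^sub>F t in at_right (0::real). dist (circ v t) v < \<epsilon> \<and> t \<in> {0<..<1}" by (rule eventually_conj)
    then obtain t :: real where t: "dist (circ v t) v < \<epsilon>" "t \<in> {0<..<1}"
      using eventually_happens'[OF trivial_limit_at_right_real] by blast
    have "v \<noteq> 0" using True by auto
    then have "circ v t \<noteq> v"
      using circ_eq_iff[of v t 0] t(2) by (auto simp: doubleton_eq_iff)
    then have "C = {}"
      using not_detached[OF v, of "circ v t" C] \<epsilon>(2)[OF _ t(1)] True det by simp
    then show False using C(1) by simp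
  next
    case False
    \<comment> \<open>The point \<open>1\<close> is an arbitrary choice on the circle. Both summands
      of \<open>A\<close> turn out empty, so that \<open>A\<close> or its complement in the fibre is
      empty.\<close>
    obtain q where q: "norm q = 1" "v \<in> seg 1 q" using exists_seg_through[of 1 v] v by auto
    obtain A1 A2 where A12: "detaches v 1 A1" "detaches v q A2"
      "A = (A1 - A2) \<union> (A2 - A1) \<or> ?K - A = (A1 - A2) \<union> (A2 - A1)"
      using detaches_sum[OF v q(2) _ q(1), of A] AB diff by (metis Un_upper1 norm_one)
    have ne: "1 \<noteq> v" "q \<noteq> v" using False q(1) by auto
    have "A1 = {}" by (rule not_detached[OF v _ ne(1) A12(1)]) (use False in auto)
    moreover have "A2 = {}" by (rule not_detached[OF v q(1) ne(2) A12(2)]) (use False in auto)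
    ultimately show False using A12(3) AB diff by auto
  qed
qed

end

theorem mainTheorem2:
  fixes d :: "complex \<Rightarrow> complex \<Rightarrow> real" and \<kappa> :: real and f :: "complex \<Rightarrow> complex"
  defines "\<Delta> \<equiv> Metric_space.mtopology (cball 0 1) d"
  assumes "Metric_space (cball 0 1) d"
    and "\<Delta> = top_of_set (cball 0 1)"
    and "Metric_space.CAT (cball 0 1) d \<kappa>"
    and "Metric_space.uniquely_geodesic (cball 0 1) d"
    and "Metric_space.geodesics_continuous (cball 0 1) d"
    and "Metric_space.saddle (cball 0 1) d f"
    and "monotone_onto (top_of_set (sphere 0 1)) (subtopology \<Delta> (sphere 0 1)) f"
  shows "monotone_onto (top_of_set (cball 0 1)) \<Delta> f"
proof -
  interpret Metric_space "cball (0::complex) 1" d by fact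
  have top: "mtopology = top_of_set (cball 0 1)" using assms(3) by (simp add: \<Delta>_def)
  obtain c where c: "\<And>x y. \<lbrakk>x \<in> cball 0 1; y \<in> cball 0 1\<rbrakk> \<Longrightarrow> geodesic_path (c x y) x y"
    and cc: "continuous_map (prod_topology (prod_topology mtopology mtopology) (top_of_set {0..1})) mtopology
      (\<lambda>((x, y), t). c x y t)"
    using assms(6) unfolding geodesics_continuous_def by blast
  have "continuous_on ((cball 0 1 \<times> cball 0 1) \<times> {0..1}) (\<lambda>((x, y), t). c x y t)"
    using cc unfolding top by (simp add: continuous_map_in_subtopology)
  then interpret geodesic_disc d c
    by unfold_locales (use assms(5) c in auto)
  have cf: "continuous_map (top_of_set (cball 0 1)) mtopology f"
    using assms(7) unfolding saddle_def by blast
  have mono: "continuous_map (top_of_set (sphere 0 1)) (top_of_set (sphere 0 1)) f"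
    "\<And>y. y \<in> sphere 0 1 \<Longrightarrow> connected {x \<in> sphere 0 1. f x = y}"
    "\<And>y. y \<in> sphere 0 1 \<Longrightarrow> {x \<in> sphere 0 1. f x = y} \<noteq> {}"
  proof -
    have sub: "subtopology \<Delta> (sphere 0 1) = top_of_set (sphere 0 1)"
      using sphere_cball[of 0 1] by (simp add: assms(3) subtopology_subtopology inf.absorb2)
    show "continuous_map (top_of_set (sphere 0 1)) (top_of_set (sphere 0 1)) f"
      "\<And>y. y \<in> sphere 0 1 \<Longrightarrow> connected {x \<in> sphere 0 1. f x = y}"
      "\<And>y. y \<in> sphere 0 1 \<Longrightarrow> {x \<in> sphere 0 1. f x = y} \<noteq> {}"
      using assms(8) unfolding sub monotone_onto_def monotone_map_def
      by (simp_all add: connectedin_subtopology)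
  qed
  interpret saddle_map d c f
  proof unfold_locales
    show "continuous_on (cball 0 1) f" using cf unfolding top by (simp add: continuous_map_in_subtopology)
    show "norm (f x) \<le> 1" if "norm x \<le> 1" for x
      using cf that unfolding top by (auto simp: continuous_map_in_subtopology)
    show "norm (f x) = 1" if "norm x = 1" for x
      using mono(1) that by (auto simp: continuous_map_in_subtopology)
    show "\<exists>x. norm x = 1 \<and> f x = y" if "norm y = 1" for y
      using mono(3)[of y] that by auto
    show "connected {x. norm x = 1 \<and> f x = y}" if "norm y = 1" for y
      using mono(2)[of y] that by simp
    show "K \<inter> sphere 0 1 \<noteq> {}"
      if "norm x \<le> 1" "norm y \<le> 1" "K \<in> components (cball 0 1 - f -` seg x y)" for x y K
      using assms(7) geodesic_segment_seg[OF that(1,2)] that unfolding saddle_def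
      by (metis mem_cball_0)
  qed
  \<comment> \<open>Only points of the disc are mapped into the disc by \<open>F\<close>, so the
    extension adds nothing to these fibres.\<close>
  have fibre: "{x \<in> cball 0 1. f x = y} = F -` {y}" if "y \<in> cball 0 1" for y
    using that norm_F_le F_in by force
  show ?thesis
    unfolding assms(3) monotone_onto_def monotone_map_def
  proof (intro conjI ballI)
    show "continuous_map (top_of_set (cball 0 1)) (top_of_set (cball 0 1)) f"
      using cf top by simp
    show "f ` topspace (top_of_set (cball 0 1)) \<subseteq> topspace (top_of_set (cball 0 1))"
      using f_disc by auto
    show "connectedin (top_of_set (cball 0 1)) {x \<in> topspace (top_of_set (cball 0 1)). f x = y}"
      if "y \<in> topspace (top_of_set (cball 0 1))" for y
      using fibre_connected[of y] fibre[of y] that by (auto simp: connectedin_subtopology)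
    show "{x \<in> topspace (top_of_set (cball 0 1)). f x = y} \<noteq> {}"
      if "y \<in> topspace (top_of_set (cball 0 1))" for y
      using fibre_nonempty[of y] fibre[of y] that by simp
  qed
qed

end
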